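(* Let $k\in\mathbb{N}$ and let $\hat p_1,\ldots,\hat p_k\in\mathbb{D}$ be given points of the split-complex plane $\mathbb{D}$. Let $S=\{x+\mathbf{k}\,y\in\mathbb{D}: x^2-y^2=0\}$. Then there exists a timelike minimal surface $$\hat X:\mathbb{D}\setminus(\{\hat p_1,\ldots,\hat p_k\}+S)\rightarrow\mathbb{E}^3_1$$ having $k$ weak complete ends at the points $\hat p_1,\ldots,\hat p_k$.
   Context: $\mathbb{E}^3_1$ is $\mathbb{R}^3$ with the Lorentzian metric $dx^2+dy^2-dz^2$; $\mathbb{E}^3$ is $\mathbb{R}^3$ with the Euclidean metric. The split-complex numbers are $\mathbb{D}=\{\hat z=x+\mathbf{k}\,y: x,y\in\mathbb{R}\}$ with $\mathbf{k}^2=1$ (commutative ring); $\operatorname{Re}(\hat z)=x$, $\operatorname{Im}(\hat z)=y$. The set $S$ consists of $0$ and the zero divisors of $\mathbb{D}$, and $\hat P+S=\{\hat p+s:\hat p\in\hat P,\ s\in S\}$. A function $\hat f=u+\mathbf{k}v$ on an open subset of $\mathbb{D}$ is split-holomorphic if it is locally given by convergent power series in $\hat z$ (in particular $u_x=v_y$, $u_y=v_x$). A split-meromorphic function is one of the form $1/\hat h$ with $\hat h$ split-holomorphic, its poles being the zeros of $\hat h$. A restriction to $\mathbb{D}$ of a bicomplex meromorphic function $G_1(\beta_1)\mathbf{e}+G_2(\beta_2)\mathbf{e}^\dagger$ with $G_1,G_2$ meromorphic on open subsets of $\mathbb{C}$ and satisfying $G_k(\bar\beta)=\overline{G_k(\beta)}$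 is also regarded as split-meromorphic, where $\mathbf{e}=\frac{1+\mathbf{k}}2$, $\mathbf{e}^\dagger=\frac{1-\mathbf{k}}2$ and $a\mathbf{e}+b\mathbf{e}^\dagger\in\mathbb{D}$ iff $a,b\in\mathbb{R}$; it has a pole at $p_1\mathbf{e}+p_2\mathbf{e}^\dagger$ if $G_1$ has a pole at $p_1$ and $G_2$ has a pole at $p_2$. A $C^2$ map $X(u,v)$ from an open subset of $\mathbb{R}^2\cong\mathbb{D}$ ($u+\mathbf{k}v$) to $\mathbb{E}^3_1$ with $\langle X_u,X_u\rangle=-\langle X_v,X_v\rangle$ and $\langle X_u,X_v\rangle=0$ is a timelike minimal surface iff $X_{uu}-X_{vv}=0$ (the induced metric is allowed to degenerate at some points). It has Weierstrass data $(\hat g,\hat f)$, with $\hat g$ split-meromorphic, $\hat f$ and $\hat f\hat g^2$ split-holomorphic on the domain of the surface, and $\operatorname{Im}(\hat g)\not\equiv0$, if $$\hat X(\hat z)=\operatorname{Re}\int^{\hat z}\hat\alpha\,d\hat z,\qquad \hat\alpha=\big(1-\hat g^2,\,2\hat g,\,1+\hat g^2\big)\hat f,$$ where the real parts of the periods of $\hat\alpha\, d\hat z$ over closed loops in the domain vanish; on a disconnected domain this means that $\hat X$ is, on each component, a primitive of $\operatorname{Re}(\hat\alpha\,d\hat z)$. Ends: let $\hat\Omega\subset\mathbb{D}$ be open, let $\hat P\subset\hat\Omega$ be the set of poles of $\hat\alpha$, and let $\hat\Omega^*=\hat\Omega\setminus(\hat P+S)$. If $\hat X:\hat\Omega^*\to\mathbb{E}^3_1$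 is a timelike minimal surface with Weierstrass data $(\hat g|_{\hat\Omega^*},\hat f|_{\hat\Omega^*})$, then each $\hat p\in\hat P$ is called an end of $\hat X$. Weak completeness: let $\hat h_{\mathbb{E}^3}$ denote the (possibly degenerate) metric induced on the surface by pulling back the Euclidean metric of $\mathbb{E}^3$ via $\hat X$. $\hat X$ is weak complete if it is complete with respect to $\hat h_{\mathbb{E}^3}$. An end $\hat p$ is a weak complete end if $\hat X$ is weak complete in a neighbourhood around $\hat p$, i.e. there is a neighbourhood $U$ of $\hat p$ such that every curve in $U\cap\hat\Omega^*$ converging to $\hat p$ has infinite $\hat h_{\mathbb{E}^3}$-length. *)

theory Defs
  imports "HOL-Complex_Analysis.Complex_Analysis"
begin

section \<open>Split-complex numbers\<close>

text \<open>The norm below is the Euclidean norm of the plane. It only serves to provide topology and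
  calculus; it is not multiplicative.\<close>

datatype split_complex = Split (sRe: real) (sIm: real)

lemma split_complex_eq_iff: "z = w \<longleftrightarrow> sRe z = sRe w \<and> sIm z = sIm w"
  by (cases z; cases w) simp

instantiation split_complex :: comm_ring_1
begin

definition "0 = Split 0 0"
definition "1 = Split 1 0"
definition "z + w = Split (sRe z + sRe w) (sIm z + sIm w)"
definition "z - w = Split (sRe z - sRe w) (sIm z - sIm w)"
definition "- z = Split (- sRe z) (- sIm z)"
definition "z * w = Split (sRe z * sRe w + sIm z * sIm w) (sRe z * sIm w + sIm z * sRe w)"

instance
  by standard
    (auto simp: split_complex_eq_iff zero_split_complex_def one_split_complex_def
      plus_split_complex_def minus_split_complex_def uminus_split_complex_def
      times_split_complex_def algebra_simps)

end

lemma split_complex_sel [simp]: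
  "sRe 0 = 0" "sIm 0 = 0" "sRe 1 = 1" "sIm 1 = 0"
  "sRe (z + w) = sRe z + sRe w" "sIm (z + w) = sIm z + sIm w"
  "sRe (z - w) = sRe z - sRe w" "sIm (z - w) = sIm z - sIm w"
  "sRe (- z) = - sRe z" "sIm (- z) = - sIm z"
  "sRe (z * w) = sRe z * sRe w + sIm z * sIm w"
  "sIm (z * w) = sRe z * sIm w + sIm z * sRe w"
  by (simp_all add: zero_split_complex_def one_split_complex_def plus_split_complex_def
      minus_split_complex_def uminus_split_complex_def times_split_complex_def)

instantiation split_complex :: real_vector
begin

definition "r *\<^sub>R z = Split (r * sRe z) (r * sIm z)"

instance
  by standard (simp_all add: split_complex_eq_iff scaleR_split_complex_def algebra_simps)

end

lemma split_complex_sel_scaleR [simp]: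
  "sRe (r *\<^sub>R z) = r * sRe z" "sIm (r *\<^sub>R z) = r * sIm z"
  by (simp_all add: scaleR_split_complex_def)

instantiation split_complex :: real_inner
begin

definition "inner z w = sRe z * sRe w + sIm z * sIm w"
definition "norm (z :: split_complex) = sqrt (inner z z)"
definition "sgn (z :: split_complex) = z /\<^sub>R norm z"
definition "dist (z :: split_complex) w = norm (z - w)"
definition uniformity_split_complex_def:
  "(uniformity :: (split_complex \<times> split_complex) filter)
    = (INF e\<in>{0 <..}. principal {(x, y). dist x y < e})"
definition open_split_complex_def:
  "open (U :: split_complex set)
    \<longleftrightarrow> (\<forall>x\<in>U. eventually (\<lambda>(x', y). x' = x \<longrightarrow> y \<in> U) uniformity)"

instance
proof
  fix r :: real and x y z :: split_complex
  show "0 \<le> inner x x"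
    by (simp add: inner_split_complex_def)
  show "(inner x x = 0) = (x = 0)"
    by (simp add: inner_split_complex_def split_complex_eq_iff sum_squares_eq_zero_iff)
  show "inner x y = inner y x"
    by (simp add: inner_split_complex_def mult.commute)
  show "inner (x + y) z = inner x z + inner y z" "inner (r *\<^sub>R x) y = r * inner x y"
    by (simp_all add: inner_split_complex_def algebra_simps)
qed (rule norm_split_complex_def sgn_split_complex_def dist_split_complex_def
      uniformity_split_complex_def open_split_complex_def)+

end

declare uniformity_Abort [where 'a = split_complex, code]

definition split_k :: split_complex
  where "split_k = Split 0 1"

definition split_e :: split_complex
  where "split_e = (1 / 2) *\<^sub>R (1 + split_k)"

definition split_e_dagger :: split_complex
  where "split_e_dagger = (1 / 2) *\<^sub>R (1 - split_k)"

instantiation split_complex :: euclidean_space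
begin

definition "Basis = {1, split_k}"

lemma inner_Basis_split_complex [simp]:
  "1 \<bullet> (1 :: split_complex) = 1" "split_k \<bullet> split_k = 1"
  "1 \<bullet> split_k = 0" "split_k \<bullet> 1 = 0" "1 \<noteq> split_k" "split_k \<noteq> 1"
  by (simp_all add: inner_split_complex_def split_k_def one_split_complex_def)

instance
proof
  fix u v x :: split_complex
  show "(Basis :: split_complex set) \<noteq> {}" "finite (Basis :: split_complex set)"
    by (simp_all add: Basis_split_complex_def)
  show "u \<in> Basis \<Longrightarrow> v \<in> Basis \<Longrightarrow> u \<bullet> v = (if u = v then 1 else 0)"
    by (auto simp: Basis_split_complex_def)
  show "(\<forall>u\<in>Basis. x \<bullet> u = 0) \<longleftrightarrow> x = 0"
    by (simp add: Basis_split_complex_def inner_split_complex_def split_k_def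
        split_complex_eq_iff[of x])
qed

end

text \<open>The coordinates with respect to the idempotents \<open>split_e\<close> and \<open>split_e_dagger\<close>.\<close>

definition e_coord :: "split_complex \<Rightarrow> real"
  where "e_coord z = sRe z + sIm z"

definition e_dagger_coord :: "split_complex \<Rightarrow> real"
  where "e_dagger_coord z = sRe z - sIm z"

lemma split_idempotent_decomposition:
  "z = e_coord z *\<^sub>R split_e + e_dagger_coord z *\<^sub>R split_e_dagger"
  by (simp add: split_complex_eq_iff e_coord_def e_dagger_coord_def split_e_def
      split_e_dagger_def split_k_def field_simps)

definition null_cone :: "split_complex set"
  where "null_cone = {z. (sRe z)\<^sup>2 - (sIm z)\<^sup>2 = 0}"

lemma null_cone_eq_zero_divisors: "null_cone = {z. \<exists>w. w \<noteq> 0 \<and> z * w = 0}"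
proof (intro set_eqI iffI)
  fix z :: split_complex assume "z \<in> null_cone"
  then have sq: "(sRe z)\<^sup>2 = (sIm z)\<^sup>2"
    by (simp add: null_cone_def)
  show "z \<in> {z. \<exists>w. w \<noteq> 0 \<and> z * w = 0}"
  proof (cases "z = 0")
    case True
    then show ?thesis
      by (auto intro!: exI[of _ 1])
  next
    case False
    then have "Split (sRe z) (- sIm z) \<noteq> 0" "z * Split (sRe z) (- sIm z) = 0"
      using sq by (auto simp: split_complex_eq_iff power2_eq_square)
    then show ?thesis by blast
  qed
next
  fix z :: split_complex assume "z \<in> {z. \<exists>w. w \<noteq> 0 \<and> z * w = 0}"
  then obtain w where w: "w \<noteq> 0" and "z * w = 0" by blast
  then have eqs: "sRe z * sRe w + sIm z * sIm w = 0" "sRe z * sIm w + sIm z * sRe w = 0"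
    by (simp_all add: split_complex_eq_iff)
  have "((sRe z)\<^sup>2 - (sIm z)\<^sup>2) * sRe w = 0" "((sRe z)\<^sup>2 - (sIm z)\<^sup>2) * sIm w = 0"
    using eqs by algebra+
  with w show "z \<in> null_cone"
    by (auto simp: null_cone_def split_complex_eq_iff)
qed

definition plus_null_cone :: "split_complex set \<Rightarrow> split_complex set"
  where "plus_null_cone P = {p + s | p s. p \<in> P \<and> s \<in> null_cone}"


section \<open>Split-holomorphic and split-meromorphic functions\<close>

definition split_holomorphic_on ::
    "(split_complex \<Rightarrow> split_complex) \<Rightarrow> split_complex set \<Rightarrow> bool"
  where "split_holomorphic_on f A \<longleftrightarrow>
    (\<forall>z\<^sub>0\<in>A. \<exists>r>0. \<exists>a :: nat \<Rightarrow> split_complex. ball z\<^sub>0 r \<subseteq> A \<and>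
       (\<forall>z\<in>ball z\<^sub>0 r. (\<lambda>n. a n * (z - z\<^sub>0) ^ n) sums f z))"

text \<open>Split-meromorphic functions are represented by total functions, whose values at singular
  points are irrelevant. The set of points near which such a function is split-holomorphic:\<close>

definition split_regular :: "(split_complex \<Rightarrow> split_complex) \<Rightarrow> split_complex \<Rightarrow> bool"
  where "split_regular f z \<longleftrightarrow> (\<exists>r>0. split_holomorphic_on f (ball z r))"

text \<open>\<open>f = 1 / h\<close> wherever \<open>h\<close> is a unit, i.e. neither zero nor a zero divisor. The density
  condition excludes functions \<open>h\<close> whose reciprocal is undefined on a nonempty open set, such as
  \<open>h = 0\<close>.\<close>

definition reciprocal_representation ::
    "split_complex set \<Rightarrow> (split_complex \<Rightarrow> split_complex) \<Rightarrow> (split_complex \<Rightarrow> split_complex) \<Rightarrow> bool"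
  where "reciprocal_representation A f h \<longleftrightarrow>
    split_holomorphic_on h A \<and>
    A \<subseteq> closure {z\<in>A. h z dvd 1} \<and>
    (\<forall>z\<in>A. h z dvd 1 \<longrightarrow> f z * h z = 1)"

text \<open>\<open>f\<close> is the restriction of a bicomplex meromorphic function. By the symmetry condition
  \<open>G\<^sub>1\<close> and \<open>G\<^sub>2\<close> are real at real points. Being nicely meromorphic means that removable
  singularities are removed.\<close>

definition bicomplex_representation ::
    "split_complex set \<Rightarrow> (split_complex \<Rightarrow> split_complex) \<Rightarrow>
     (complex \<Rightarrow> complex) \<Rightarrow> (complex \<Rightarrow> complex) \<Rightarrow> bool"
  where "bicomplex_representation A f G\<^sub>1 G\<^sub>2 \<longleftrightarrow>
    (\<exists>U\<^sub>1 U\<^sub>2. open U\<^sub>1 \<and> open U\<^sub>2 \<and> G\<^sub>1 nicely_meromorphic_on U\<^sub>1 \<and> G\<^sub>2 nicely_meromorphic_on U\<^sub>2 \<and>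
       (\<forall>\<beta>\<in>U\<^sub>1. cnj \<beta> \<in> U\<^sub>1 \<and> G\<^sub>1 (cnj \<beta>) = cnj (G\<^sub>1 \<beta>)) \<and>
       (\<forall>\<beta>\<in>U\<^sub>2. cnj \<beta> \<in> U\<^sub>2 \<and> G\<^sub>2 (cnj \<beta>) = cnj (G\<^sub>2 \<beta>)) \<and>
       (\<forall>z\<in>A. complex_of_real (e_coord z) \<in> U\<^sub>1 \<and> complex_of_real (e_dagger_coord z) \<in> U\<^sub>2 \<and>
          (\<not> is_pole G\<^sub>1 (complex_of_real (e_coord z)) \<and>
           \<not> is_pole G\<^sub>2 (complex_of_real (e_dagger_coord z)) \<longrightarrow>
             f z = Re (G\<^sub>1 (complex_of_real (e_coord z))) *\<^sub>R split_e
                 + Re (G\<^sub>2 (complex_of_real (e_dagger_coord z))) *\<^sub>R split_e_dagger)))"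

definition split_meromorphic_on ::
    "(split_complex \<Rightarrow> split_complex) \<Rightarrow> split_complex set \<Rightarrow> bool"
  where "split_meromorphic_on f A \<longleftrightarrow> open A \<and>
    ((\<exists>h. reciprocal_representation A f h) \<or> (\<exists>G\<^sub>1 G\<^sub>2. bicomplex_representation A f G\<^sub>1 G\<^sub>2))"

definition split_poles ::
    "(split_complex \<Rightarrow> split_complex) \<Rightarrow> split_complex set \<Rightarrow> split_complex set"
  where "split_poles f A = {p\<in>A.
    (\<exists>h. reciprocal_representation A f h \<and> h p = 0) \<or>
    (\<exists>G\<^sub>1 G\<^sub>2. bicomplex_representation A f G\<^sub>1 G\<^sub>2 \<and>
       is_pole G\<^sub>1 (complex_of_real (e_coord p)) \<and>
       is_pole G\<^sub>2 (complex_of_real (e_dagger_coord p)))}"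


section \<open>Timelike minimal surfaces in Lorentz-Minkowski space\<close>

text \<open>The underlying space is \<^typ>\<open>real^3\<close>, whose library inner product and norm are those of
  Euclidean space.\<close>

definition lorentz :: "real^3 \<Rightarrow> real^3 \<Rightarrow> real"
  where "lorentz x y = x$1 * y$1 + x$2 * y$2 - x$3 * y$3"

text \<open>Partial derivatives with respect to \<open>u\<close> and \<open>v\<close>, where \<open>z = u + split_k * v\<close>.\<close>

definition partial_u :: "(split_complex \<Rightarrow> real^3) \<Rightarrow> split_complex \<Rightarrow> real^3"
  where "partial_u X z = frechet_derivative X (at z) 1"

definition partial_v :: "(split_complex \<Rightarrow> real^3) \<Rightarrow> split_complex \<Rightarrow> real^3"
  where "partial_v X z = frechet_derivative X (at z) split_k"

text \<open>Class \<open>C\<^sup>2\<close>, for open \<open>A\<close>.\<close>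

definition C2_on :: "(split_complex \<Rightarrow> real^3) \<Rightarrow> split_complex set \<Rightarrow> bool"
  where "C2_on X A \<longleftrightarrow>
    X differentiable_on A \<and>
    partial_u X differentiable_on A \<and> partial_v X differentiable_on A \<and>
    continuous_on A (partial_u (partial_u X)) \<and> continuous_on A (partial_v (partial_u X)) \<and>
    continuous_on A (partial_u (partial_v X)) \<and> continuous_on A (partial_v (partial_v X))"

definition timelike_minimal_surface :: "split_complex set \<Rightarrow> (split_complex \<Rightarrow> real^3) \<Rightarrow> bool"
  where "timelike_minimal_surface A X \<longleftrightarrow>
    open A \<and> C2_on X A \<and>
    (\<forall>z\<in>A. lorentz (partial_u X z) (partial_u X z) = - lorentz (partial_v X z) (partial_v X z) \<and>
           lorentz (partial_u X z) (partial_v X z) = 0) \<and>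
    (\<forall>z\<in>A. partial_u (partial_u X) z - partial_v (partial_v X) z = 0)"


section \<open>Weierstrass data and ends\<close>

text \<open>\<open>\<alpha> = (1 - g\<^sup>2, 2 g, 1 + g\<^sup>2) f\<close>, as an identity of meromorphic functions.\<close>

definition weierstrass_form ::
    "split_complex set \<Rightarrow> (split_complex \<Rightarrow> split_complex) \<Rightarrow> (split_complex \<Rightarrow> split_complex) \<Rightarrow>
     (split_complex \<Rightarrow> split_complex^3) \<Rightarrow> bool"
  where "weierstrass_form A g f \<alpha> \<longleftrightarrow>
    (\<forall>z\<in>A. split_regular g z \<and> split_regular f z \<longrightarrow>
       \<alpha> z = vector [(1 - (g z)\<^sup>2) * f z, 2 * g z * f z, (1 + (g z)\<^sup>2) * f z])"

text \<open>In the following definition \<open>q\<close> is \<open>f g\<^sup>2\<close> and \<open>\<alpha>\<close> is the Weierstrass form, both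
  continued across the singularities of \<open>g\<close>. The last conjunct says that \<open>X\<close> is a primitive of
  the real part of \<open>\<alpha> dz\<close>; this contains the vanishing of the real periods.\<close>

definition has_weierstrass_data ::
    "split_complex set \<Rightarrow> (split_complex \<Rightarrow> real^3) \<Rightarrow>
     (split_complex \<Rightarrow> split_complex) \<Rightarrow> (split_complex \<Rightarrow> split_complex) \<Rightarrow> bool"
  where "has_weierstrass_data A X g f \<longleftrightarrow>
    split_meromorphic_on g A \<and>
    split_holomorphic_on f A \<and>
    (\<exists>q. split_holomorphic_on q A \<and> (\<forall>z\<in>A. split_regular g z \<longrightarrow> q z = f z * (g z)\<^sup>2)) \<and>
    (\<exists>z\<in>A. split_regular g z \<and> sIm (g z) \<noteq> 0) \<and>
    (\<exists>\<alpha>. (\<forall>i. split_holomorphic_on (\<lambda>z. \<alpha> z $ i) A) \<and> weierstrass_form A g f \<alpha> \<and>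
       (\<forall>z\<in>A. (X has_derivative (\<lambda>h. \<chi> i. sRe (\<alpha> z $ i * h))) (at z)))"

text \<open>\<open>X\<close> is a timelike minimal surface on \<open>\<Omega> - (P + S)\<close> whose Weierstrass data are restrictions
  of \<open>g\<close> and \<open>f\<close>, where \<open>P\<close> is the set of poles of the Weierstrass form on \<open>\<Omega>\<close>, i.e. the set
  of ends of \<open>X\<close>. A vector-valued function has a pole where one of its components has one.\<close>

definition timelike_minimal_surface_with_ends ::
    "split_complex set \<Rightarrow> split_complex set \<Rightarrow> (split_complex \<Rightarrow> real^3) \<Rightarrow>
     (split_complex \<Rightarrow> split_complex) \<Rightarrow> (split_complex \<Rightarrow> split_complex) \<Rightarrow> bool"
  where "timelike_minimal_surface_with_ends \<Omega> P X g f \<longleftrightarrow>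
    open \<Omega> \<and> split_meromorphic_on g \<Omega> \<and> split_meromorphic_on f \<Omega> \<and>
    (\<exists>\<alpha>. (\<forall>i. split_meromorphic_on (\<lambda>z. \<alpha> z $ i) \<Omega>) \<and> weierstrass_form \<Omega> g f \<alpha> \<and>
         P = (\<Union>i. split_poles (\<lambda>z. \<alpha> z $ i) \<Omega>)) \<and>
    timelike_minimal_surface (\<Omega> - plus_null_cone P) X \<and>
    has_weierstrass_data (\<Omega> - plus_null_cone P) X g f"


section \<open>Weak completeness\<close>

text \<open>The pullback of the Euclidean metric.\<close>

definition euclidean_pullback ::
    "(split_complex \<Rightarrow> real^3) \<Rightarrow> split_complex \<Rightarrow> split_complex \<Rightarrow> split_complex \<Rightarrow> real"
  where "euclidean_pullback X z v w =
    frechet_derivative X (at z) v \<bullet> frechet_derivative X (at z) w"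

definition pullback_length :: "(split_complex \<Rightarrow> real^3) \<Rightarrow> (real \<Rightarrow> split_complex) \<Rightarrow> ennreal"
  where "pullback_length X \<gamma> =
    (\<integral>\<^sup>+t\<in>{0..<1}. ennreal (sqrt (euclidean_pullback X (\<gamma> t)
        (vector_derivative \<gamma> (at t)) (vector_derivative \<gamma> (at t)))) \<partial>lborel)"

text \<open>Curves converging to \<open>p\<close> are parametrised by \<open>[0,1)\<close> and are piecewise \<open>C\<^sup>1\<close> on compact
  subintervals.\<close>

definition weak_complete_end ::
    "split_complex set \<Rightarrow> (split_complex \<Rightarrow> real^3) \<Rightarrow> split_complex \<Rightarrow> bool"
  where "weak_complete_end A X p \<longleftrightarrow>
    (\<exists>U. open U \<and> p \<in> U \<and>
      (\<forall>\<gamma> :: real \<Rightarrow> split_complex.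
         (\<forall>T\<in>{0<..<1}. \<gamma> piecewise_C1_differentiable_on {0..T}) \<and>
         \<gamma> ` {0..<1} \<subseteq> U \<inter> A \<and>
         (\<gamma> \<longlongrightarrow> p) (at_left 1) \<longrightarrow>
         pullback_length X \<gamma> = \<infinity>))"

end

theory Submission
  imports Defs
begin

text \<open>In the idempotent coordinates \<open>a = e_coord z\<close>, \<open>b = e_dagger_coord z\<close> split-holomorphic
  functions decouple into a function of \<open>a\<close> and a function of \<open>b\<close>. Take the constant Gauss map
  \<open>g = split_k\<close>. As \<open>g\<^sup>2 = 1\<close>, the Weierstrass form is \<open>(0, 2 g f, 2 f)\<close>, and if
  \<open>f\<close> has components \<open>\<phi>'(a)\<close> and \<open>\<psi>'(b)\<close>, then
  \<open>X = (0, \<phi>(a) - \<psi>(b), \<phi>(a) + \<psi>(b))\<close>. With \<open>\<phi>(a) = \<Sum> 1 / (a - a\<^sub>i)\<close> and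
  \<open>\<psi>(b) = \<Sum> 1 / (b - b\<^sub>i)\<close>, where \<open>a\<^sub>i\<close>, \<open>b\<^sub>i\<close> are the coordinates of the prescribed points,
  the residues vanish and \<open>X\<close> is globally defined. Every point \<open>(a\<^sub>i, b\<^sub>j)\<close> is a pole, so there are
  in general more ends than prescribed, but they span the same null lines. Since \<open>X\<close> tends to
  infinity at each end, every curve running into an end has infinite length.\<close>

section \<open>Idempotent coordinates\<close>

lemma split_complex_eqI:
  assumes "e_coord z = e_coord w" "e_dagger_coord z = e_dagger_coord w"
  shows "z = w"
  using assms by (simp add: split_complex_eq_iff e_coord_def e_dagger_coord_def)

lemma e_coord_simps [simp]:
  "e_coord 0 = 0" "e_coord 1 = 1" "e_coord split_e = 1" "e_coord split_e_dagger = 0"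
  "e_coord (z + w) = e_coord z + e_coord w" "e_coord (z - w) = e_coord z - e_coord w"
  "e_coord (z * w) = e_coord z * e_coord w" "e_coord (r *\<^sub>R z) = r * e_coord z"
  by (simp_all add: e_coord_def split_e_def split_e_dagger_def split_k_def algebra_simps)

lemma e_dagger_coord_simps [simp]:
  "e_dagger_coord 0 = 0" "e_dagger_coord 1 = 1"
  "e_dagger_coord split_e = 0" "e_dagger_coord split_e_dagger = 1"
  "e_dagger_coord (z + w) = e_dagger_coord z + e_dagger_coord w"
  "e_dagger_coord (z - w) = e_dagger_coord z - e_dagger_coord w"
  "e_dagger_coord (z * w) = e_dagger_coord z * e_dagger_coord w"
  "e_dagger_coord (r *\<^sub>R z) = r * e_dagger_coord z"
  by (simp_all add: e_dagger_coord_def split_e_def split_e_dagger_def split_k_def algebra_simps)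

lemma e_coord_power [simp]:
  "e_coord (z ^ n) = e_coord z ^ n" "e_dagger_coord (z ^ n) = e_dagger_coord z ^ n"
  by (induction n) simp_all

lemma sRe_eq_coords: "sRe z = (e_coord z + e_dagger_coord z) / 2"
  and sIm_eq_coords: "sIm z = (e_coord z - e_dagger_coord z) / 2"
  by (simp_all add: e_coord_def e_dagger_coord_def)

lemma abs_sRe_le_norm: "\<bar>sRe z\<bar> \<le> norm z"
  and abs_sIm_le_norm: "\<bar>sIm z\<bar> \<le> norm z"
  using real_sqrt_ge_abs1[of "sRe z" "sIm z"] real_sqrt_ge_abs2[of "sIm z" "sRe z"]
  by (simp_all add: norm_split_complex_def inner_split_complex_def power2_eq_square)

lemma abs_e_coord_le_norm: "\<bar>e_coord z\<bar> \<le> 2 * norm z"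
  and abs_e_dagger_coord_le_norm: "\<bar>e_dagger_coord z\<bar> \<le> 2 * norm z"
  using abs_sRe_le_norm[of z] abs_sIm_le_norm[of z] by (auto simp: e_coord_def e_dagger_coord_def)

lemma bounded_linear_sRe: "bounded_linear sRe"
  and bounded_linear_sIm: "bounded_linear sIm"
  by (rule bounded_linear_intro[of _ 1]; use abs_sRe_le_norm abs_sIm_le_norm in force)+

lemma bounded_linear_e_coord: "bounded_linear e_coord"
  and bounded_linear_e_dagger_coord: "bounded_linear e_dagger_coord"
  by (rule bounded_linear_intro[of _ 2];
      use abs_e_coord_le_norm abs_e_dagger_coord_le_norm in \<open>force simp: mult.commute\<close>)+

lemmas continuous_on_e_coord [continuous_intros] =
  bounded_linear.continuous_on[OF bounded_linear_e_coord]
lemmas continuous_on_e_dagger_coord [continuous_intros] =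
  bounded_linear.continuous_on[OF bounded_linear_e_dagger_coord]

text \<open>The quadratic form factors as \<open>e_coord z * e_dagger_coord z\<close>, so the cone
  is the union of the two axes of the idempotent coordinates.\<close>

lemma mem_null_cone_iff: "z \<in> null_cone \<longleftrightarrow> e_coord z = 0 \<or> e_dagger_coord z = 0"
proof -
  have "(sRe z)\<^sup>2 - (sIm z)\<^sup>2 = e_coord z * e_dagger_coord z"
    by (simp add: e_coord_def e_dagger_coord_def power2_eq_square algebra_simps)
  then show ?thesis by (auto simp: null_cone_def)
qed

text \<open>The removed set depends on \<open>P\<close> only through its two coordinate projections.
  Hence additional poles on the grid of prescribed coordinates leave the domain unchanged.\<close>

lemma plus_null_cone_eq:
  "plus_null_cone P = {z. e_coord z \<in> e_coord ` P \<or> e_dagger_coord z \<in> e_dagger_coord ` P}"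
proof -
  have "z \<in> plus_null_cone P \<longleftrightarrow> (\<exists>p\<in>P. z - p \<in> null_cone)" for z
    unfolding plus_null_cone_def by (force simp: algebra_simps intro: exI[of _ "z - _"])
  then show ?thesis
    by (auto simp: mem_null_cone_iff)
qed

section \<open>Restrictions of bicomplex functions\<close>

definition bicomplex_domain :: "complex set \<Rightarrow> complex set \<Rightarrow> split_complex set"
  where "bicomplex_domain U\<^sub>1 U\<^sub>2 =
    {z. complex_of_real (e_coord z) \<in> U\<^sub>1 \<and> complex_of_real (e_dagger_coord z) \<in> U\<^sub>2}"

text \<open>The formula of \<open>bicomplex_representation\<close> made total: at a pole it uses
  whatever value the function is assigned there. Taking \<open>Re\<close> loses nothing for
  functions that are real on the real axis.\<close>

definition bicomplex_restriction ::
    "(complex \<Rightarrow> complex) \<Rightarrow> (complex \<Rightarrow> complex) \<Rightarrow> split_complex \<Rightarrow> split_complex"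
  where "bicomplex_restriction G\<^sub>1 G\<^sub>2 z =
    Re (G\<^sub>1 (complex_of_real (e_coord z))) *\<^sub>R split_e
    + Re (G\<^sub>2 (complex_of_real (e_dagger_coord z))) *\<^sub>R split_e_dagger"

lemma bicomplex_restriction_coords [simp]:
  "e_coord (bicomplex_restriction G\<^sub>1 G\<^sub>2 z) = Re (G\<^sub>1 (complex_of_real (e_coord z)))"
  "e_dagger_coord (bicomplex_restriction G\<^sub>1 G\<^sub>2 z) = Re (G\<^sub>2 (complex_of_real (e_dagger_coord z)))"
  by (simp_all add: bicomplex_restriction_def)

lemma open_bicomplex_domain:
  assumes "open U\<^sub>1" "open U\<^sub>2"
  shows "open (bicomplex_domain U\<^sub>1 U\<^sub>2)"
proof -
  have "bicomplex_domain U\<^sub>1 U\<^sub>2 =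
    (\<lambda>z. complex_of_real (e_coord z)) -` U\<^sub>1 \<inter> (\<lambda>z. complex_of_real (e_dagger_coord z)) -` U\<^sub>2"
    by (auto simp: bicomplex_domain_def)
  then show ?thesis
    using assms by (auto intro!: open_Int open_vimage continuous_intros)
qed

text \<open>Multiplication is componentwise in idempotent coordinates, so two real Taylor series
  combine into one split-complex series whose coefficients have theirs as coordinates. At real
  arguments the powers are real, so \<open>Re\<close> passes to the Taylor coefficients.\<close>

lemma split_holomorphic_on_bicomplex_restriction:
  assumes U: "open U\<^sub>1" "open U\<^sub>2"
    and G: "G\<^sub>1 holomorphic_on U\<^sub>1" "G\<^sub>2 holomorphic_on U\<^sub>2"
  shows "split_holomorphic_on (bicomplex_restriction G\<^sub>1 G\<^sub>2) (bicomplex_domain U\<^sub>1 U\<^sub>2)"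
  unfolding split_holomorphic_on_def
proof
  fix z\<^sub>0 assume z\<^sub>0: "z\<^sub>0 \<in> bicomplex_domain U\<^sub>1 U\<^sub>2"
  let ?x = "e_coord z\<^sub>0" and ?y = "e_dagger_coord z\<^sub>0"
  obtain r\<^sub>1 where r\<^sub>1: "r\<^sub>1 > 0" "ball (complex_of_real ?x) r\<^sub>1 \<subseteq> U\<^sub>1"
    using U(1) z\<^sub>0 by (auto simp: bicomplex_domain_def open_contains_ball)
  obtain r\<^sub>2 where r\<^sub>2: "r\<^sub>2 > 0" "ball (complex_of_real ?y) r\<^sub>2 \<subseteq> U\<^sub>2"
    using U(2) z\<^sub>0 by (auto simp: bicomplex_domain_def open_contains_ball)
  have real_series: "(\<lambda>n. Re ((deriv ^^ n) G (complex_of_real x) / fact n) * (y - x) ^ n)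
      sums Re (G (complex_of_real y))"
    if "G holomorphic_on ball (complex_of_real x) r" "\<bar>y - x\<bar> < r" for G x y r
  proof -
    have "complex_of_real y \<in> ball (complex_of_real x) r"
      using that(2) by (simp add: dist_of_real dist_real_def)
    from sums_Re[OF holomorphic_power_series[OF that(1) this]]
    show ?thesis
      by (simp flip: of_real_diff of_real_power times_divide_eq_left)
  qed
  define a where "a n = Re ((deriv ^^ n) G\<^sub>1 (complex_of_real ?x) / fact n) *\<^sub>R split_e
    + Re ((deriv ^^ n) G\<^sub>2 (complex_of_real ?y) / fact n) *\<^sub>R split_e_dagger" for n
  \<comment> \<open>The radius is halved because a coordinate is bounded only by twice the
    norm.\<close>
  have *: "\<bar>e_coord z - ?x\<bar> < r\<^sub>1" "\<bar>e_dagger_coord z - ?y\<bar> < r\<^sub>2"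
    if "z \<in> ball z\<^sub>0 (min r\<^sub>1 r\<^sub>2 / 2)" for z
    using that abs_e_coord_le_norm[of "z - z\<^sub>0"] abs_e_dagger_coord_le_norm[of "z - z\<^sub>0"]
    by (auto simp: dist_norm norm_minus_commute)
  have "ball z\<^sub>0 (min r\<^sub>1 r\<^sub>2 / 2) \<subseteq> bicomplex_domain U\<^sub>1 U\<^sub>2"
  proof
    fix z assume "z \<in> ball z\<^sub>0 (min r\<^sub>1 r\<^sub>2 / 2)"
    from *[OF this] show "z \<in> bicomplex_domain U\<^sub>1 U\<^sub>2"
      using r\<^sub>1(2) r\<^sub>2(2)
      by (auto simp: bicomplex_domain_def subset_iff dist_of_real dist_real_def abs_minus_commute)
  qed
  moreover have "(\<lambda>n. a n * (z - z\<^sub>0) ^ n) sums bicomplex_restriction G\<^sub>1 G\<^sub>2 z"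
    if z: "z \<in> ball z\<^sub>0 (min r\<^sub>1 r\<^sub>2 / 2)" for z
  proof -
    have "(\<lambda>n. (Re ((deriv ^^ n) G\<^sub>1 (complex_of_real ?x) / fact n) * (e_coord z - ?x) ^ n) *\<^sub>R split_e
        + (Re ((deriv ^^ n) G\<^sub>2 (complex_of_real ?y) / fact n) * (e_dagger_coord z - ?y) ^ n)
            *\<^sub>R split_e_dagger) sums bicomplex_restriction G\<^sub>1 G\<^sub>2 z"
      unfolding bicomplex_restriction_def using *[OF z] r\<^sub>1(2) r\<^sub>2(2) G
      by (intro sums_add bounded_linear.sums[OF bounded_linear_scaleR_left] real_series)
        (auto intro: holomorphic_on_subset)
    then show ?thesis
      by (rule back_subst[of "\<lambda>f. f sums _"]) (auto simp: a_def intro!: ext split_complex_eqI)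
  qed
  ultimately show "\<exists>r>0. \<exists>a. ball z\<^sub>0 r \<subseteq> bicomplex_domain U\<^sub>1 U\<^sub>2 \<and>
      (\<forall>z\<in>ball z\<^sub>0 r. (\<lambda>n. a n * (z - z\<^sub>0) ^ n) sums bicomplex_restriction G\<^sub>1 G\<^sub>2 z)"
    using r\<^sub>1(1) r\<^sub>2(1) by (intro exI[of _ "min r\<^sub>1 r\<^sub>2 / 2"] conjI exI[of _ a]) auto
qed

lemma bicomplex_representation_restriction:
  assumes "G\<^sub>1 nicely_meromorphic_on UNIV" "G\<^sub>2 nicely_meromorphic_on UNIV"
    and "\<And>\<beta>. G\<^sub>1 (cnj \<beta>) = cnj (G\<^sub>1 \<beta>)" "\<And>\<beta>. G\<^sub>2 (cnj \<beta>) = cnj (G\<^sub>2 \<beta>)"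
  shows "bicomplex_representation A (bicomplex_restriction G\<^sub>1 G\<^sub>2) G\<^sub>1 G\<^sub>2"
  unfolding bicomplex_representation_def
  by (rule exI[of _ UNIV], rule exI[of _ UNIV])
    (intro conjI ballI impI open_UNIV UNIV_I assms bicomplex_restriction_def)

text \<open>The norm is not multiplicative, so continuity is proved coordinatewise: each coordinate
  is a ring homomorphism to the reals and turns the expansion into a real power series.\<close>

lemma isCont_split_holomorphic:
  assumes "split_holomorphic_on h A" "z\<^sub>0 \<in> A"
  shows "isCont h z\<^sub>0"
proof -
  obtain r a where r: "r > 0" and sums: "\<And>z. z \<in> ball z\<^sub>0 r \<Longrightarrow> (\<lambda>n. a n * (z - z\<^sub>0) ^ n) sums h z"
    using assms unfolding split_holomorphic_on_def by meson
  have coord: "isCont (\<lambda>z. c (h z)) z\<^sub>0"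
    if c: "bounded_linear c" "\<And>z w n. c (z * w ^ n) = c z * c w ^ n" and e: "c e = 1"
    for c :: "split_complex \<Rightarrow> real" and e
  proof -
    have c_sums: "(\<lambda>n. c (a n) * c (z - z\<^sub>0) ^ n) sums c (h z)" if "z \<in> ball z\<^sub>0 r" for z
      using bounded_linear.sums[OF c(1) sums[OF that]] by (simp add: c(2))
    \<comment> \<open>Moving from \<open>z\<^sub>0\<close> by \<open>R\<close> along the idempotent
      \<open>e\<close> stays in the ball and changes the coordinate \<open>c\<close> by exactly
      \<open>R\<close>. The real series thus converges at \<open>R > 0\<close> and is continuous at
      0.\<close>
    define R where "R = r / (2 * norm e)"
    have "norm e > 0"
      using e linear_0[OF bounded_linear.linear[OF c(1)]] by auto
    then have R: "R > 0" "z\<^sub>0 + R *\<^sub>R e \<in> ball z\<^sub>0 r"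
      using r by (auto simp: R_def dist_norm)
    have "c (R *\<^sub>R e) = R"
      using e bounded_linear.linear[OF c(1)] by (simp add: linear_scale)
    then have "summable (\<lambda>n. c (a n) * R ^ n)"
      using sums_summable[OF c_sums[OF R(2)]] by simp
    then have "isCont (\<lambda>x. \<Sum>n. c (a n) * x ^ n) 0"
      using R(1) by (intro isCont_powser[of _ R]) auto
    moreover have "isCont (\<lambda>z. c (z - z\<^sub>0)) z\<^sub>0"
      by (intro bounded_linear.isCont[OF c(1)] continuous_intros)
    ultimately have "isCont (\<lambda>z. \<Sum>n. c (a n) * c (z - z\<^sub>0) ^ n) z\<^sub>0"
      using linear_0[OF bounded_linear.linear[OF c(1)]]
      by (intro isCont_o2[where f = "\<lambda>z. c (z - z\<^sub>0)" and g = "\<lambda>x. \<Sum>n. c (a n) * x ^ n"]) simp_all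
    moreover have "eventually (\<lambda>z. (\<Sum>n. c (a n) * c (z - z\<^sub>0) ^ n) = c (h z)) (nhds z\<^sub>0)"
      using eventually_nhds_in_open[of "ball z\<^sub>0 r" z\<^sub>0] r
      by (auto elim!: eventually_mono intro!: sums_unique[symmetric] c_sums)
    ultimately show ?thesis
      by (simp add: isCont_cong)
  qed
  have "isCont (\<lambda>z. e_coord (h z) *\<^sub>R split_e + e_dagger_coord (h z) *\<^sub>R split_e_dagger) z\<^sub>0"
    by (intro continuous_intros coord[of _ split_e] coord[of _ split_e_dagger]
        bounded_linear_e_coord bounded_linear_e_dagger_coord) simp_all
  then show ?thesis
    by (simp flip: split_idempotent_decomposition)
qed

text \<open>Punctured real neighbourhoods map into punctured complex ones, so limits at a pole can
  be taken along the real axis.\<close>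

lemma filterlim_of_real_at:
  "filterlim (of_real :: real \<Rightarrow> 'a :: real_normed_algebra_1) (at (of_real x)) (at x)"
  by (auto simp: filterlim_at eventually_at_filter intro!: tendsto_intros)

section \<open>Poles\<close>

lemma eventually_not_is_pole:
  assumes "G nicely_meromorphic_on U" "z \<in> U"
  shows "eventually (\<lambda>w. \<not> is_pole G w) (at z)"
proof -
  have "isolated_singularity_at G z"
    using nicely_meromorphic_on_subset[OF assms(1), of "{z}"] assms(2)
    using meromorphic_on_isolated_singularity unfolding nicely_meromorphic_on_def by blast
  then obtain r where r: "r > 0" "G analytic_on ball z r - {z}"
    unfolding isolated_singularity_at_def by blast
  have "\<not> is_pole G w" if "w \<in> ball z r - {z}" for w
    using analytic_at_imp_no_pole[OF analytic_on_subset[OF r(2), of "{w}"]] that by simp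
  then show ?thesis
    unfolding eventually_at using r(1) by (intro exI[of _ r]) (auto simp: dist_commute)
qed

text \<open>A pole may be witnessed by any representation of either kind, so what is extracted is a
  property of the function itself: arbitrarily close to a pole, both coordinates are large at one
  common point.\<close>

lemma split_poles_unbounded:
  assumes q: "q \<in> split_poles F A" and A: "open A" and \<epsilon>: "\<epsilon> > 0"
  obtains z where "z \<in> ball q \<epsilon>" "\<bar>e_coord (F z)\<bar> > K" "\<bar>e_dagger_coord (F z)\<bar> > K"
proof -
  have qA: "q \<in> A"
    using q by (simp add: split_poles_def)
  consider (reciprocal) h where "reciprocal_representation A F h" "h q = 0"
    | (bicomplex) G\<^sub>1 G\<^sub>2 where "bicomplex_representation A F G\<^sub>1 G\<^sub>2"
      "is_pole G\<^sub>1 (complex_of_real (e_coord q))" "is_pole G\<^sub>2 (complex_of_real (e_dagger_coord q))"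
    using q unfolding split_poles_def by blast
  then show ?thesis
  proof cases
    case reciprocal
    \<comment> \<open>With \<open>norm (h z) < \<delta>\<close> both coordinates of
      \<open>h z\<close> are below \<open>1 / (\<bar>K\<bar> + 1)\<close>, so their reciprocals, the
      coordinates of \<open>F z\<close>, exceed \<open>K\<close> in absolute value.\<close>
    define \<delta> where "\<delta> = 1 / (2 * (\<bar>K\<bar> + 1))"
    have \<delta>: "\<delta> > 0"
      by (simp add: \<delta>_def)
    have "isCont h q"
      using reciprocal(1) qA isCont_split_holomorphic
      unfolding reciprocal_representation_def by blast
    then obtain \<eta> where \<eta>: "\<eta> > 0" "\<And>z. dist z q < \<eta> \<Longrightarrow> norm (h z) < \<delta>"
      using \<delta> reciprocal(2) unfolding continuous_at_eps_delta by (metis dist_0_norm dist_commute)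
    \<comment> \<open>Since \<open>h q = 0\<close> is not a unit, a point where \<open>F\<close> is
      the reciprocal of \<open>h\<close> comes from the density condition.\<close>
    have "q \<in> closure {z\<in>A. h z dvd 1}"
      using reciprocal(1) qA unfolding reciprocal_representation_def by blast
    then obtain z where z: "z \<in> A" "h z dvd 1" "dist z q < min \<epsilon> \<eta>"
      using \<epsilon> \<eta>(1) unfolding closure_approachable
      by (metis (mono_tags, lifting) mem_Collect_eq min_less_iff_conj)
    have Fh: "F z * h z = 1"
      using reciprocal(1) z unfolding reciprocal_representation_def by blast
    have large: "K < \<bar>x\<bar>" if "x * y = 1" "\<bar>y\<bar> \<le> 2 * norm (h z)" for x y :: real
    proof -
      have "2 * \<delta> = 1 / (\<bar>K\<bar> + 1)"
        by (simp add: \<delta>_def field_simps)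
      then have "\<bar>y\<bar> < 1 / (\<bar>K\<bar> + 1)"
        using that(2) \<eta>(2)[of z] z(3) by linarith
      then have "\<bar>y\<bar> * (\<bar>K\<bar> + 1) < 1"
        by (simp add: pos_less_divide_eq)
      then have "\<bar>y\<bar> * (\<bar>K\<bar> + 1) < \<bar>y\<bar> * \<bar>x\<bar>"
        using that(1) by (metis abs_mult abs_one mult.commute)
      then have "\<bar>K\<bar> + 1 < \<bar>x\<bar>"
        by (simp add: mult_less_cancel_left)
      then show ?thesis by linarith
    qed
    have "e_coord (F z) * e_coord (h z) = 1" "e_dagger_coord (F z) * e_dagger_coord (h z) = 1"
      using arg_cong[OF Fh, of e_coord] arg_cong[OF Fh, of e_dagger_coord] by simp_all
    then show ?thesis
      using that[of z] large z(3) abs_e_coord_le_norm abs_e_dagger_coord_le_norm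
      by (auto simp: dist_commute)
  next
    case bicomplex
    obtain U\<^sub>1 U\<^sub>2 where
      G: "G\<^sub>1 nicely_meromorphic_on U\<^sub>1" "G\<^sub>2 nicely_meromorphic_on U\<^sub>2"
      and sym: "\<And>\<beta>. \<beta> \<in> U\<^sub>1 \<Longrightarrow> G\<^sub>1 (cnj \<beta>) = cnj (G\<^sub>1 \<beta>)"
        "\<And>\<beta>. \<beta> \<in> U\<^sub>2 \<Longrightarrow> G\<^sub>2 (cnj \<beta>) = cnj (G\<^sub>2 \<beta>)"
      and U: "\<And>z. z \<in> A \<Longrightarrow> complex_of_real (e_coord z) \<in> U\<^sub>1"
        "\<And>z. z \<in> A \<Longrightarrow> complex_of_real (e_dagger_coord z) \<in> U\<^sub>2"
      and F: "\<And>z. z \<in> A \<Longrightarrow> \<not> is_pole G\<^sub>1 (complex_of_real (e_coord z)) \<Longrightarrow>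
           \<not> is_pole G\<^sub>2 (complex_of_real (e_dagger_coord z)) \<Longrightarrow>
             F z = Re (G\<^sub>1 (complex_of_real (e_coord z))) *\<^sub>R split_e
                 + Re (G\<^sub>2 (complex_of_real (e_dagger_coord z))) *\<^sub>R split_e_dagger"
      using bicomplex(1) unfolding bicomplex_representation_def by blast
    obtain r where r: "r > 0" "ball q r \<subseteq> A"
      using A qA by (auto simp: open_contains_ball)
    define s where "s = min r \<epsilon> / 2"
    have s: "s > 0"
      using r \<epsilon> by (simp add: s_def)
    \<comment> \<open>The formula for \<open>F\<close> holds only off the poles, so the real point
      must avoid them as well as give a large value. Both conditions hold on a punctured
      neighbourhood.\<close>
    have nearby: "\<exists>x. \<bar>x - x\<^sub>0\<bar> < s \<and> \<not> is_pole G (complex_of_real x) \<and> K < norm (G (complex_of_real x))"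
      if "is_pole G (complex_of_real x\<^sub>0)" "G nicely_meromorphic_on U" "complex_of_real x\<^sub>0 \<in> U"
      for G U x\<^sub>0
    proof -
      have "eventually (\<lambda>w. K < norm (G w)) (at (complex_of_real x\<^sub>0))"
        using that(1) unfolding is_pole_def
        by (metis filterlim_at_infinity_imp_norm_at_top filterlim_at_top_dense)
      with eventually_not_is_pole[OF that(2,3)]
      have "eventually (\<lambda>w. \<not> is_pole G w \<and> K < norm (G w)) (at (complex_of_real x\<^sub>0))"
        by (rule eventually_conj)
      then have "eventually (\<lambda>x. \<not> is_pole G (complex_of_real x) \<and> K < norm (G (complex_of_real x))) (at x\<^sub>0)"
        by (rule eventually_compose_filterlim) (rule filterlim_of_real_at)
      moreover have "eventually (\<lambda>x. \<bar>x - x\<^sub>0\<bar> < s) (at x\<^sub>0)"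
        using s by (auto simp: eventually_at dist_real_def)
      ultimately have "eventually (\<lambda>x. \<bar>x - x\<^sub>0\<bar> < s \<and> \<not> is_pole G (complex_of_real x)
          \<and> K < norm (G (complex_of_real x))) (at x\<^sub>0)"
        by eventually_elim simp
      from eventually_happens'[OF _ this] show ?thesis by simp
    qed
    obtain x where x: "\<bar>x - e_coord q\<bar> < s" "\<not> is_pole G\<^sub>1 (complex_of_real x)"
        "K < norm (G\<^sub>1 (complex_of_real x))"
      using nearby[OF bicomplex(2) G(1) U(1)[OF qA]] by blast
    obtain y where y: "\<bar>y - e_dagger_coord q\<bar> < s" "\<not> is_pole G\<^sub>2 (complex_of_real y)"
        "K < norm (G\<^sub>2 (complex_of_real y))"
      using nearby[OF bicomplex(3) G(2) U(2)[OF qA]] by blast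
    \<comment> \<open>The two coordinates are independent, so the separately chosen \<open>x\<close>
      and \<open>y\<close> form a single point.\<close>
    define z where "z = x *\<^sub>R split_e + y *\<^sub>R split_e_dagger"
    have z [simp]: "e_coord z = x" "e_dagger_coord z = y"
      by (simp_all add: z_def)
    have "norm (z - q) \<le> \<bar>sRe (z - q)\<bar> + \<bar>sIm (z - q)\<bar>"
      unfolding norm_split_complex_def inner_split_complex_def
      using sqrt_sum_squares_le_sum_abs by (simp add: power2_eq_square)
    also have "\<dots> < 2 * s"
      using x(1) y(1) abs_triangle_ineq[of "x - e_coord q" "y - e_dagger_coord q"]
        abs_triangle_ineq4[of "x - e_coord q" "y - e_dagger_coord q"]
      by (simp add: sRe_eq_coords sIm_eq_coords abs_divide)
    finally have zq: "norm (z - q) < min r \<epsilon>"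
      by (simp add: s_def)
    then have zA: "z \<in> A"
      using r(2) by (auto simp: subset_iff dist_norm norm_minus_commute)
    \<comment> \<open>Conjugation symmetry makes the values at real points real, so largeness in
      modulus survives \<open>Re\<close>.\<close>
    have real: "norm (G (complex_of_real t)) = \<bar>Re (G (complex_of_real t))\<bar>"
      if "G (cnj (complex_of_real t)) = cnj (G (complex_of_real t))" for G t
      using that by (auto simp: complex_eq_iff cmod_eq_Re)
    have Fz: "F z = Re (G\<^sub>1 (complex_of_real x)) *\<^sub>R split_e
        + Re (G\<^sub>2 (complex_of_real y)) *\<^sub>R split_e_dagger"
      using F[OF zA] x(2) y(2) by (simp only: z not_False_eq_True)
    have "\<bar>e_coord (F z)\<bar> = norm (G\<^sub>1 (complex_of_real x))"
      using real[OF sym(1)[OF U(1)[OF zA]]] by (simp add: Fz)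
    moreover have "\<bar>e_dagger_coord (F z)\<bar> = norm (G\<^sub>2 (complex_of_real y))"
      using real[OF sym(2)[OF U(2)[OF zA]]] by (simp add: Fz)
    ultimately have "\<bar>e_coord (F z)\<bar> > K" "\<bar>e_dagger_coord (F z)\<bar> > K"
      using x(3) y(3) by simp_all
    then show ?thesis
      using that[of z] zq by (simp add: dist_norm norm_minus_commute)
  qed
qed

text \<open>Continuity of one coordinate function would bound it near \<open>q\<close>, against
  \<open>split_poles_unbounded\<close>. This confines poles to the grid of singular coordinates,
  whichever representation witnesses them.\<close>

lemma split_poles_coords:
  assumes q: "q \<in> split_poles F A" and A: "open A"
    and F: "\<And>z. e_coord (F z) = \<phi> (e_coord z)" "\<And>z. e_dagger_coord (F z) = \<psi> (e_dagger_coord z)"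
  shows "\<not> isCont \<phi> (e_coord q)" "\<not> isCont \<psi> (e_dagger_coord q)"
proof -
  have bound: "\<exists>\<epsilon>>0. \<forall>z\<in>ball q \<epsilon>. \<bar>\<theta> (c z)\<bar> \<le> \<bar>\<theta> (c q)\<bar> + 1"
    if "isCont \<theta> (c q)" "bounded_linear c" for \<theta> :: "real \<Rightarrow> real" and c :: "split_complex \<Rightarrow> real"
  proof -
    have "isCont (\<lambda>z. \<theta> (c z)) q"
      using that(1) by (intro isCont_o2[where f = c and g = \<theta>] bounded_linear.isCont[OF that(2)] continuous_ident)
    then obtain \<epsilon> where "\<epsilon> > 0" "\<And>z. dist z q < \<epsilon> \<Longrightarrow> dist (\<theta> (c z)) (\<theta> (c q)) < 1"
      unfolding continuous_at_eps_delta by (metis zero_less_one)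
    then show ?thesis
      by (intro exI[of _ \<epsilon>]) (force simp: dist_commute dist_real_def)
  qed
  show "\<not> isCont \<phi> (e_coord q)"
  proof
    assume "isCont \<phi> (e_coord q)"
    from bound[OF this bounded_linear_e_coord] obtain \<epsilon>
      where "\<epsilon> > 0" "\<forall>z\<in>ball q \<epsilon>. \<bar>\<phi> (e_coord z)\<bar> \<le> \<bar>\<phi> (e_coord q)\<bar> + 1" by blast
    with split_poles_unbounded[OF q A] show False
      by (metis F(1) not_less)
  qed
  show "\<not> isCont \<psi> (e_dagger_coord q)"
  proof
    assume "isCont \<psi> (e_dagger_coord q)"
    from bound[OF this bounded_linear_e_dagger_coord] obtain \<epsilon>
      where "\<epsilon> > 0" "\<forall>z\<in>ball q \<epsilon>. \<bar>\<psi> (e_dagger_coord z)\<bar> \<le> \<bar>\<psi> (e_dagger_coord q)\<bar> + 1" by blast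
    with split_poles_unbounded[OF q A] show False
      by (metis F(2) not_less)
  qed
qed

section \<open>Lengths of curves\<close>

text \<open>The norm of the velocity of \<open>X \<circ> \<gamma>\<close> is the speed in the
  pulled-back metric, so the fundamental theorem of calculus bounds displacement by length up to
  \<open>T\<close>, hence by the whole length.\<close>

lemma dist_le_pullback_length:
  assumes A: "open A" and X: "C2_on X A"
    and \<gamma>: "\<gamma> piecewise_C1_differentiable_on {0..T}" "\<gamma> ` {0..T} \<subseteq> A"
    and T: "0 \<le> T" "T < 1"
  shows "ennreal (norm (X (\<gamma> T) - X (\<gamma> 0))) \<le> pullback_length X \<gamma>"
proof -
  obtain S where S: "finite S" "\<gamma> C1_differentiable_on ({0..T} - S)" and cont: "continuous_on {0..T} \<gamma>"
    using \<gamma>(1) unfolding piecewise_C1_differentiable_on_def by blast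
  define B where "B = {0..T} - S"
  obtain D where D: "\<And>t. t \<in> B \<Longrightarrow> (\<gamma> has_vector_derivative D t) (at t)" "continuous_on B D"
    using S(2) unfolding C1_differentiable_on_def B_def by blast
  have XD: "(X has_derivative frechet_derivative X (at z)) (at z)" if "z \<in> A" for z
    using X A that frechet_derivative_works
    unfolding C2_on_def by (metis differentiable_on_eq_differentiable_at)
  define Y where "Y t = frechet_derivative X (at (\<gamma> t)) (D t)" for t
  have YD: "((\<lambda>t. X (\<gamma> t)) has_vector_derivative Y t) (at t)" if "t \<in> B" for t
  proof -
    have "\<gamma> t \<in> A"
      using that \<gamma>(2) by (auto simp: B_def)
    from has_derivative_compose[OF D(1)[OF that, unfolded has_vector_derivative_def] XD[OF this]]
    show ?thesis
      using linear_scale[OF has_derivative_linear[OF XD[OF \<open>\<gamma> t \<in> A\<close>]]]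
      by (simp add: has_vector_derivative_def Y_def)
  qed
  \<comment> \<open>\<open>C2_on\<close> gives continuity of the partial derivatives; this expansion
    transfers it to \<open>Y\<close> and thereby yields measurability.\<close>
  have Y_eq: "Y t = sRe (D t) *\<^sub>R partial_u X (\<gamma> t) + sIm (D t) *\<^sub>R partial_v X (\<gamma> t)" if "t \<in> B" for t
  proof -
    have "\<gamma> t \<in> A"
      using that \<gamma>(2) by (auto simp: B_def)
    note lin = has_derivative_linear[OF XD[OF this]]
    have "D t = sRe (D t) *\<^sub>R 1 + sIm (D t) *\<^sub>R split_k"
      by (simp add: split_complex_eq_iff split_k_def)
    then have "Y t = frechet_derivative X (at (\<gamma> t)) (sRe (D t) *\<^sub>R 1 + sIm (D t) *\<^sub>R split_k)"
      by (simp add: Y_def)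
    then show ?thesis
      by (simp only: linear_add[OF lin] linear_scale[OF lin] partial_u_def partial_v_def)
  qed
  have \<gamma>B: "continuous_on B \<gamma>" "\<gamma> ` B \<subseteq> A"
    using cont \<gamma>(2) by (auto simp: B_def intro: continuous_on_subset)
  have "continuous_on A (partial_u X)" "continuous_on A (partial_v X)"
    using X by (auto simp: C2_on_def intro: differentiable_imp_continuous_on)
  then have "continuous_on B (\<lambda>t. partial_u X (\<gamma> t))" "continuous_on B (\<lambda>t. partial_v X (\<gamma> t))"
    using \<gamma>B by (auto intro: continuous_on_compose2)
  moreover have "continuous_on B (\<lambda>t. sRe (D t))" "continuous_on B (\<lambda>t. sIm (D t))"
    using bounded_linear.continuous_on[OF bounded_linear_sRe D(2)]
      bounded_linear.continuous_on[OF bounded_linear_sIm D(2)] by simp_all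
  ultimately have
    "continuous_on B (\<lambda>t. sRe (D t) *\<^sub>R partial_u X (\<gamma> t) + sIm (D t) *\<^sub>R partial_v X (\<gamma> t))"
    by (intro continuous_on_add continuous_on_scaleR)
  then have Y_cont: "continuous_on B Y"
    by (rule continuous_on_eq) (simp add: Y_eq)
  have X\<gamma>: "continuous_on {0..T} (\<lambda>t. X (\<gamma> t))"
    by (rule continuous_on_compose2[OF differentiable_imp_continuous_on cont \<gamma>(2)])
      (use X in \<open>simp add: C2_on_def\<close>)
  \<comment> \<open>Cutting off outside \<open>B\<close> gives a Borel function on the whole line;
    within \<open>{0..T}\<close> it alters \<open>Y\<close> only on the finite set \<open>S\<close>,
    leaving the integral unchanged.\<close>
  define Z where "Z t = indicat_real B t *\<^sub>R Y t" for t
  have "(Y has_integral (X (\<gamma> T) - X (\<gamma> 0))) {0..T}"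
    using YD T(1) X\<gamma> by (intro fundamental_theorem_of_calculus_strong[OF S(1)]) (auto simp: B_def)
  then have "((\<lambda>t. if t \<in> {0..T} then Y t else 0) has_integral (X (\<gamma> T) - X (\<gamma> 0))) UNIV"
    by (simp only: has_integral_restrict_UNIV)
  then have Z_integral: "(Z has_integral (X (\<gamma> T) - X (\<gamma> 0))) UNIV"
    by (rule has_integral_spike_finite[OF S(1), rotated]) (auto simp: Z_def B_def)
  have "B \<in> sets borel"
    unfolding B_def using S(1) by (intro sets.Diff borel_closed finite_imp_closed closed_atLeastAtMost)
  then have Z_meas: "Z \<in> borel_measurable lborel"
    using borel_measurable_continuous_on_indicator[OF _ Y_cont] by (simp add: Z_def[abs_def])
  have le: "(\<integral>\<^sup>+t. ennreal (norm (Z t)) \<partial>lborel) \<le> pullback_length X \<gamma>"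
    unfolding pullback_length_def
  proof (rule nn_integral_mono)
    fix t
    show "ennreal (norm (Z t)) \<le> ennreal (sqrt (euclidean_pullback X (\<gamma> t)
        (vector_derivative \<gamma> (at t)) (vector_derivative \<gamma> (at t)))) * indicator {0..<1} t"
    proof (cases "t \<in> B")
      case True
      then have "t \<in> {0..<1}" "vector_derivative \<gamma> (at t) = D t"
        using T(2) D(1) by (auto simp: B_def vector_derivative_at)
      then show ?thesis
        using True by (simp add: Z_def Y_def euclidean_pullback_def norm_eq_sqrt_inner)
    qed (simp add: Z_def)
  qed
  show ?thesis
  \<comment> \<open>Finite length makes \<open>Z\<close> Lebesgue integrable, so its gauge integral
    equals its Lebesgue integral and the norm bound applies.\<close>
  proof (cases "pullback_length X \<gamma> = \<infinity>")
    case False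
    then have Z_int: "integrable lborel Z"
      using le Z_meas by (intro integrableI_bounded) (auto simp: top.not_eq_extremum order_le_less_trans)
    have "X (\<gamma> T) - X (\<gamma> 0) = integral\<^sup>L lborel Z"
      using has_integral_unique[OF Z_integral has_integral_integral_lborel[OF Z_int]] .
    then show ?thesis
      using integral_norm_bound_ennreal[OF Z_int] le by simp
  qed simp
qed

text \<open>A curve of finite length \<open>l\<close> stays within distance \<open>l\<close> of its
  starting value in space, whereas \<open>X\<close> blows up along every curve tending to
  \<open>p\<close>. The whole plane serves as the neighbourhood.\<close>

lemma weak_complete_end_if_unbounded:
  assumes A: "open A" and X: "C2_on X A" and p: "p \<notin> A"
    and lim: "filterlim X at_infinity (at p within A)"
  shows "weak_complete_end A X p"
  unfolding weak_complete_end_def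
proof (intro exI[of _ UNIV] conjI allI impI; (elim conjE)?)
  fix \<gamma> :: "real \<Rightarrow> split_complex"
  assume C1: "\<forall>T\<in>{0<..<1}. \<gamma> piecewise_C1_differentiable_on {0..T}"
    and in_A: "\<gamma> ` {0..<1} \<subseteq> UNIV \<inter> A" and to_p: "(\<gamma> \<longlongrightarrow> p) (at_left 1)"
  have interior: "eventually (\<lambda>t. t \<in> {0<..<1}) (at_left (1::real))"
    using eventually_at_left[of 0 "1::real"] by (auto intro: exI[of _ 0])
  have "eventually (\<lambda>t. \<gamma> t \<in> A \<and> \<gamma> t \<noteq> p) (at_left 1)"
    using interior by eventually_elim (use in_A p in \<open>auto simp: image_subset_iff\<close>)
  then have "filterlim \<gamma> (at p within A) (at_left 1)"
    using to_p by (simp add: filterlim_at eventually_conj_iff)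
  from filterlim_compose[OF lim this]
  have X_lim: "filterlim (\<lambda>t. norm (X (\<gamma> t))) at_top (at_left 1)"
    by (rule filterlim_at_infinity_imp_norm_at_top)
  show "pullback_length X \<gamma> = \<infinity>"
  proof (rule ccontr)
    assume "pullback_length X \<gamma> \<noteq> \<infinity>"
    then obtain l where l: "pullback_length X \<gamma> = ennreal l" "l \<ge> 0"
      by (metis ennreal_cases infinity_ennreal_def)
    have "eventually (\<lambda>t. norm (X (\<gamma> 0)) + l < norm (X (\<gamma> t))) (at_left 1)"
      using X_lim by (simp add: filterlim_at_top_dense)
    with interior have "eventually (\<lambda>t. t \<in> {0<..<1} \<and> norm (X (\<gamma> 0)) + l < norm (X (\<gamma> t))) (at_left 1)"
      by (rule eventually_conj)
    from eventually_happens'[OF _ this] obtain T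
      where T: "0 < T" "T < 1" "norm (X (\<gamma> 0)) + l < norm (X (\<gamma> T))" by auto
    have "ennreal (norm (X (\<gamma> T) - X (\<gamma> 0))) \<le> ennreal l"
      using dist_le_pullback_length[OF A X, of \<gamma> T] T C1 in_A l(1) by (auto simp: image_subset_iff)
    then have "norm (X (\<gamma> T) - X (\<gamma> 0)) \<le> l"
      using l(2) by simp
    then show False
      using T(3) norm_triangle_sub[of "X (\<gamma> T)" "X (\<gamma> 0)"] by linarith
  qed
qed simp_all

section \<open>Surfaces with Gauss map \<open>split_k\<close>\<close>

text \<open>The d'Alembert form of a surface in the plane where the first coordinate vanishes: a sum
  of two motions along the fixed null directions (0, 1, 1) and (0, -1, 1).\<close>

definition null_sum :: "(complex \<Rightarrow> complex) \<Rightarrow> (complex \<Rightarrow> complex) \<Rightarrow> split_complex \<Rightarrow> real^3"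
  where "null_sum F\<^sub>1 F\<^sub>2 z =
    Re (F\<^sub>1 (complex_of_real (e_coord z))) *\<^sub>R vector [0, 1, 1]
    + Re (F\<^sub>2 (complex_of_real (e_dagger_coord z))) *\<^sub>R vector [0, - 1, 1]"

lemma has_derivative_Re_of_real:
  assumes "open U" "F holomorphic_on U" "complex_of_real (c z) \<in> U" "bounded_linear c"
  shows "((\<lambda>z. Re (F (complex_of_real (c z)))) has_derivative
    (\<lambda>h. Re (deriv F (complex_of_real (c z))) * c h)) (at z)"
proof -
  have "(F has_field_derivative deriv F (complex_of_real (c z))) (at (complex_of_real (c z)))"
    using assms by (simp add: holomorphic_derivI)
  then have "((\<lambda>x. Re (F (complex_of_real x))) has_vector_derivative
      Re (deriv F (complex_of_real (c z)))) (at (c z))"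
    by (intro bounded_linear.has_vector_derivative[OF bounded_linear_Re] has_vector_derivative_real_field)
  from has_derivative_compose[OF bounded_linear_imp_has_derivative[OF assms(4)]
      this[unfolded has_vector_derivative_def]]
  show ?thesis
    by (simp add: mult.commute)
qed

context
  fixes U\<^sub>1 U\<^sub>2 F\<^sub>1 F\<^sub>2
  assumes U: "open U\<^sub>1" "open U\<^sub>2" and F: "F\<^sub>1 holomorphic_on U\<^sub>1" "F\<^sub>2 holomorphic_on U\<^sub>2"
begin

lemma has_derivative_null_sum:
  assumes "z \<in> bicomplex_domain U\<^sub>1 U\<^sub>2"
  shows "(null_sum F\<^sub>1 F\<^sub>2 has_derivative
    (\<lambda>h. (Re (deriv F\<^sub>1 (complex_of_real (e_coord z))) * e_coord h) *\<^sub>R vector [0, 1, 1]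
      + (Re (deriv F\<^sub>2 (complex_of_real (e_dagger_coord z))) * e_dagger_coord h)
        *\<^sub>R vector [0, - 1, 1])) (at z)"
  unfolding null_sum_def[abs_def] using assms U F
  by (intro has_derivative_add has_derivative_scaleR_left has_derivative_Re_of_real
      bounded_linear_e_coord bounded_linear_e_dagger_coord)
    (auto simp: bicomplex_domain_def)

text \<open>The directions \<open>1\<close> and \<open>split_k\<close> have idempotent coordinates
  (1, 1) and (1, -1), so both partial derivatives are again null sums. Requiring the equation for
  \<open>X\<close> only on the domain lets the lemma be applied again to these partial
  derivatives.\<close>

lemma partial_null_sum:
  assumes X: "\<And>z. z \<in> bicomplex_domain U\<^sub>1 U\<^sub>2 \<Longrightarrow> X z = null_sum F\<^sub>1 F\<^sub>2 z"
    and z: "z \<in> bicomplex_domain U\<^sub>1 U\<^sub>2"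
  shows "X differentiable at z"
    and "partial_u X z = null_sum (deriv F\<^sub>1) (deriv F\<^sub>2) z"
    and "partial_v X z = null_sum (deriv F\<^sub>1) (\<lambda>\<beta>. - deriv F\<^sub>2 \<beta>) z"
proof -
  note D = has_derivative_transform_within_open[OF has_derivative_null_sum[OF z]
      open_bicomplex_domain[OF U] z X[symmetric]]
  show "X differentiable at z"
    using D by (blast intro: differentiableI)
  have "e_coord split_k = 1" "e_dagger_coord split_k = - 1"
    by (simp_all add: e_coord_def e_dagger_coord_def split_k_def)
  then show "partial_u X z = null_sum (deriv F\<^sub>1) (deriv F\<^sub>2) z"
    "partial_v X z = null_sum (deriv F\<^sub>1) (\<lambda>\<beta>. - deriv F\<^sub>2 \<beta>) z"
    by (simp_all add: partial_u_def partial_v_def frechet_derivative_at[OF D, symmetric] null_sum_def)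
qed

lemma continuous_on_null_sum: "continuous_on (bicomplex_domain U\<^sub>1 U\<^sub>2) (null_sum F\<^sub>1 F\<^sub>2)"
  using has_derivative_null_sum has_derivative_continuous continuous_at_imp_continuous_on by blast

end

text \<open>The partial derivatives are \<open>a + b\<close> and \<open>a - b\<close> with
  \<open>a\<close>, \<open>b\<close> null, so their Lorentz squares are opposite, both being a
  multiple of the product of \<open>a\<close> and \<open>b\<close>, and their mutual product
  vanishes.\<close>

lemma timelike_minimal_surface_null_sum:
  assumes U: "open U\<^sub>1" "open U\<^sub>2" and F: "F\<^sub>1 holomorphic_on U\<^sub>1" "F\<^sub>2 holomorphic_on U\<^sub>2"
  shows "timelike_minimal_surface (bicomplex_domain U\<^sub>1 U\<^sub>2) (null_sum F\<^sub>1 F\<^sub>2)"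
proof -
  let ?A = "bicomplex_domain U\<^sub>1 U\<^sub>2" and ?X = "null_sum F\<^sub>1 F\<^sub>2"
  note F' = holomorphic_deriv[OF F(1) U(1)] holomorphic_deriv[OF F(2) U(2)]
  note F'' = holomorphic_deriv[OF F'(1) U(1)] holomorphic_deriv[OF F'(2) U(2)]
  note mF' = holomorphic_on_minus[OF F'(2)]
  note mF'' = holomorphic_deriv[OF mF' U(2)]
  have A: "open ?A"
    by (rule open_bicomplex_domain[OF U])
  note X = partial_null_sum[OF U F refl]
  note Xu = partial_null_sum[OF U F' X(2)]
  note Xv = partial_null_sum[OF U F'(1) mF' X(3)]
  have "C2_on ?X ?A"
    unfolding C2_on_def
  proof (intro conjI)
    show "?X differentiable_on ?A" "partial_u ?X differentiable_on ?A" "partial_v ?X differentiable_on ?A"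
      using X(1) Xu(1) Xv(1) A by (simp_all add: differentiable_on_eq_differentiable_at)
    show "continuous_on ?A (partial_u (partial_u ?X))"
      using continuous_on_null_sum[OF U F''] by (rule continuous_on_eq) (simp add: Xu)
    show "continuous_on ?A (partial_v (partial_u ?X))"
      using continuous_on_null_sum[OF U F''(1) holomorphic_on_minus[OF F''(2)]]
      by (rule continuous_on_eq) (simp add: Xu)
    show "continuous_on ?A (partial_u (partial_v ?X))"
      using continuous_on_null_sum[OF U F''(1) mF''] by (rule continuous_on_eq) (simp add: Xv)
    show "continuous_on ?A (partial_v (partial_v ?X))"
      using continuous_on_null_sum[OF U F''(1) holomorphic_on_minus[OF mF'']]
      by (rule continuous_on_eq) (simp add: Xv)
  qed
  moreover have "lorentz (partial_u ?X z) (partial_u ?X z) = - lorentz (partial_v ?X z) (partial_v ?X z)"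
    "lorentz (partial_u ?X z) (partial_v ?X z) = 0" if "z \<in> ?A" for z
    using that by (simp_all add: X(2,3) null_sum_def lorentz_def vector_3 algebra_simps)
  moreover have "partial_u (partial_u ?X) z - partial_v (partial_v ?X) z = 0" if z: "z \<in> ?A" for z
  proof -
    \<comment> \<open>Differentiating twice in \<open>v\<close> changes the sign of the second
      summand twice, which gives the wave equation.\<close>
    have "deriv (\<lambda>\<beta>. - deriv F\<^sub>2 \<beta>) (complex_of_real (e_dagger_coord z))
        = - deriv (deriv F\<^sub>2) (complex_of_real (e_dagger_coord z))"
      using z U(2) by (intro DERIV_imp_deriv DERIV_minus holomorphic_derivI[OF F'(2)])
        (auto simp: bicomplex_domain_def)
    then show ?thesis
      using z by (simp add: Xu(2) Xv(3) null_sum_def)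
  qed
  ultimately show ?thesis
    using A unfolding timelike_minimal_surface_def by blast
qed

section \<open>Surfaces with prescribed ends\<close>

definition pole_sum :: "nat \<Rightarrow> real set \<Rightarrow> complex \<Rightarrow> complex"
  where "pole_sum n A \<beta> = (\<Sum>a\<in>A. 1 / (\<beta> - complex_of_real a) ^ n)"

lemma pole_sum_cnj: "pole_sum n A (cnj \<beta>) = cnj (pole_sum n A \<beta>)"
  by (simp add: pole_sum_def)

lemma holomorphic_on_pole_sum: "pole_sum n A holomorphic_on - complex_of_real ` A"
  unfolding pole_sum_def[abs_def] by (intro holomorphic_intros) auto

lemma deriv_pole_sum:
  assumes "\<beta> \<notin> complex_of_real ` A"
  shows "deriv (pole_sum 1 A) \<beta> = - pole_sum 2 A \<beta>"
proof -
  have "((\<lambda>\<beta>. 1 / (\<beta> - complex_of_real a) ^ 1) has_field_derivative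
      - (1 / (\<beta> - complex_of_real a) ^ 2)) (at \<beta>)" if "a \<in> A" for a
    using assms that by (auto intro!: derivative_eq_intros simp: power2_eq_square)
  then have "(pole_sum 1 A has_field_derivative (\<Sum>a\<in>A. - (1 / (\<beta> - complex_of_real a) ^ 2))) (at \<beta>)"
    unfolding pole_sum_def[abs_def] by (rule DERIV_sum)
  then show ?thesis
    by (simp add: DERIV_imp_deriv pole_sum_def sum_negf)
qed

text \<open>The summand belonging to \<open>a\<close> has the pole, and the remaining sum is
  continuous at \<open>a\<close>, so nothing cancels.\<close>

lemma is_pole_pole_sum:
  assumes "finite A" "a \<in> A" "n > 0"
  shows "is_pole (pole_sum n A) (complex_of_real a)"
proof -
  have eq: "pole_sum n A = (\<lambda>\<beta>. 1 / (\<beta> - complex_of_real a) ^ n + pole_sum n (A - {a}) \<beta>)"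
    using assms by (simp add: pole_sum_def fun_eq_iff sum.remove)
  have "open (- complex_of_real ` (A - {a}))"
    using assms(1) by (simp add: finite_imp_closed open_Compl)
  then have "isCont (pole_sum n (A - {a})) (complex_of_real a)"
    using holomorphic_on_imp_continuous_on[OF holomorphic_on_pole_sum, of "A - {a}" n]
    by (auto simp: continuous_on_eq_continuous_at)
  then show ?thesis
    unfolding is_pole_def eq isCont_def
    by (rule tendsto_add_filterlim_at_infinity'[rotated])
      (use is_pole_inverse_power[OF assms(3)] in \<open>simp add: is_pole_def\<close>)
qed

text \<open>A nicely meromorphic function takes the value \<open>0\<close> at its poles; the sum would contribute
  the regular part there.\<close>

definition end_form :: "real set \<Rightarrow> complex \<Rightarrow> complex"
  where "end_form A \<beta> = (if \<beta> \<in> complex_of_real ` A then 0 else - pole_sum 2 A \<beta>)"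

lemma end_form_cnj: "end_form A (cnj \<beta>) = cnj (end_form A \<beta>)"
proof -
  have "cnj \<beta> \<in> complex_of_real ` A \<longleftrightarrow> \<beta> \<in> complex_of_real ` A"
    by (metis (no_types, lifting) complex_cnj_cnj complex_cnj_complex_of_real image_iff)
  then show ?thesis
    by (simp add: end_form_def pole_sum_cnj)
qed

text \<open>The double poles carry no residue: \<open>pole_sum 1 A\<close> is a single-valued
  primitive, which is why no periods arise.\<close>

lemma end_form_eq_deriv: "\<beta> \<notin> complex_of_real ` A \<Longrightarrow> end_form A \<beta> = deriv (pole_sum 1 A) \<beta>"
  by (simp add: end_form_def deriv_pole_sum del: One_nat_def)

lemma holomorphic_on_end_form: "end_form A holomorphic_on - complex_of_real ` A"
  by (rule holomorphic_transform[OF holomorphic_on_minus[OF holomorphic_on_pole_sum[of 2 A]]])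
    (simp add: end_form_def)

lemma is_pole_end_form:
  assumes "finite A" "a \<in> A"
  shows "is_pole (end_form A) (complex_of_real a)"
proof -
  have "open (- complex_of_real ` (A - {a}))"
    using assms(1) by (simp add: finite_imp_closed open_Compl)
  then have "eventually (\<lambda>\<beta>. \<beta> \<in> - complex_of_real ` (A - {a}) - {complex_of_real a}) (at (complex_of_real a))"
    by (intro eventually_at_in_open) auto
  then have ev: "eventually (\<lambda>\<beta>. - pole_sum 2 A \<beta> = end_form A \<beta>) (at (complex_of_real a))"
    by eventually_elim (auto simp: end_form_def)
  show ?thesis
    by (rule is_pole_transform[OF _ ev refl]) (simp add: is_pole_pole_sum[OF assms])
qed

lemma nicely_meromorphic_end_form:
  assumes "finite A"
  shows "end_form A nicely_meromorphic_on UNIV"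
proof (rule nicely_meromorphic_onI_open[where pts = "complex_of_real ` A"])
  have op: "open (- complex_of_real ` B)" if "B \<subseteq> A" for B
    using assms that by (meson finite_imageI finite_imp_closed finite_subset open_Compl)
  then show "end_form A analytic_on UNIV - complex_of_real ` A"
    using holomorphic_on_end_form by (simp add: analytic_on_open Compl_eq_Diff_UNIV[symmetric])
  show "is_pole (end_form A) x \<and> end_form A x = 0" if "x \<in> complex_of_real ` A" for x
    using that is_pole_end_form[OF assms] by (auto simp: end_form_def)
  show "isolated_singularity_at (end_form A) x" for x
  proof -
    \<comment> \<open>Only the poles other than \<open>x\<close> are excluded, which treats poles
      and regular points alike.\<close>
    let ?V = "- (complex_of_real ` A - {x})"
    have "open ?V"
      using assms by (simp add: finite_imp_closed open_Compl del: Compl_Diff_eq)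
    then obtain r where "r > 0" "ball x r \<subseteq> ?V"
      by (auto simp: open_contains_ball)
    then have "end_form A holomorphic_on ball x r - {x}"
      by (intro holomorphic_on_subset[OF holomorphic_on_end_form]) auto
    then show ?thesis
      using \<open>r > 0\<close> unfolding isolated_singularity_at_def
      by (intro exI[of _ r]) (simp add: analytic_on_open open_delete)
  qed
qed simp

lemma bicomplex_domain_Compl_eq:
  "bicomplex_domain (- complex_of_real ` e_coord ` P) (- complex_of_real ` e_dagger_coord ` P)
    = UNIV - plus_null_cone P"
  by (auto simp: bicomplex_domain_def plus_null_cone_eq image_iff)

lemma split_meromorphic_on_bicomplex_restriction:
  assumes "G\<^sub>1 nicely_meromorphic_on UNIV" "G\<^sub>2 nicely_meromorphic_on UNIV"
    and "\<And>\<beta>. G\<^sub>1 (cnj \<beta>) = cnj (G\<^sub>1 \<beta>)" "\<And>\<beta>. G\<^sub>2 (cnj \<beta>) = cnj (G\<^sub>2 \<beta>)"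
    and "open A"
  shows "split_meromorphic_on (bicomplex_restriction G\<^sub>1 G\<^sub>2) A"
  using bicomplex_representation_restriction[OF assms(1-4)] assms(5)
  unfolding split_meromorphic_on_def by blast

text \<open>The definition requires the expansion ball to lie inside the set, so passing to a
  smaller ball means shrinking the radii.\<close>

lemma split_regular_if_holomorphic:
  assumes "split_holomorphic_on f UNIV"
  shows "split_regular f z"
  unfolding split_regular_def split_holomorphic_on_def
proof (rule exI[of _ 1], intro conjI ballI)
  fix w assume w: "w \<in> ball z 1"
  obtain r a where r: "r > 0" "\<And>x. x \<in> ball w r \<Longrightarrow> (\<lambda>n. a n * (x - w) ^ n) sums f x"
    using assms unfolding split_holomorphic_on_def by (meson UNIV_I)
  obtain s where s: "s > 0" "ball w s \<subseteq> ball z 1"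
    using w open_ball open_contains_ball by blast
  show "\<exists>r>0. \<exists>a. ball w r \<subseteq> ball z 1 \<and> (\<forall>x\<in>ball w r. (\<lambda>n. a n * (x - w) ^ n) sums f x)"
    using r s by (intro exI[of _ "min r s"] conjI exI[of _ a]) auto
qed simp

text \<open>Adding the second and third components cancels the contribution of
  \<open>F\<^sub>2\<close> and leaves twice that of \<open>F\<^sub>1\<close>, so a pole in the first
  coordinate alone forces the surface to infinity.\<close>

lemma filterlim_null_sum_at_infinity:
  assumes pole: "is_pole F\<^sub>1 (complex_of_real (e_coord p))"
    and F\<^sub>1: "\<And>\<beta>. F\<^sub>1 (cnj \<beta>) = cnj (F\<^sub>1 \<beta>)"
    and D: "\<And>z. z \<in> D \<Longrightarrow> e_coord z \<noteq> e_coord p"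
  shows "filterlim (null_sum F\<^sub>1 F\<^sub>2) at_infinity (at p within D)"
proof -
  have "filterlim e_coord (at (e_coord p)) (at p within D)"
    using bounded_linear.tendsto[OF bounded_linear_e_coord tendsto_ident_at, of p D] D
    by (auto simp: filterlim_at eventually_at_filter)
  then have "filterlim (\<lambda>z. complex_of_real (e_coord z)) (at (complex_of_real (e_coord p))) (at p within D)"
    by (rule filterlim_compose[OF filterlim_of_real_at])
  then have "filterlim (\<lambda>z. F\<^sub>1 (complex_of_real (e_coord z))) at_infinity (at p within D)"
    by (rule filterlim_compose[OF pole[unfolded is_pole_def]])
  then have lim: "filterlim (\<lambda>z. norm (F\<^sub>1 (complex_of_real (e_coord z)))) at_top (at p within D)"
    by (rule filterlim_at_infinity_imp_norm_at_top)
  have "norm (F\<^sub>1 (complex_of_real (e_coord z))) \<le> norm (null_sum F\<^sub>1 F\<^sub>2 z)" for z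
  proof -
    have "cnj (F\<^sub>1 (complex_of_real (e_coord z))) = F\<^sub>1 (complex_of_real (e_coord z))"
      using F\<^sub>1[of "complex_of_real (e_coord z)"] by simp
    then have "norm (F\<^sub>1 (complex_of_real (e_coord z))) = \<bar>Re (F\<^sub>1 (complex_of_real (e_coord z)))\<bar>"
      by (auto simp: complex_eq_iff cmod_eq_Re)
    moreover have "2 * Re (F\<^sub>1 (complex_of_real (e_coord z)))
        = null_sum F\<^sub>1 F\<^sub>2 z $ 2 + null_sum F\<^sub>1 F\<^sub>2 z $ 3"
      by (simp add: null_sum_def vector_3)
    ultimately show ?thesis
      using component_le_norm_cart[of "null_sum F\<^sub>1 F\<^sub>2 z" 2]
        component_le_norm_cart[of "null_sum F\<^sub>1 F\<^sub>2 z" 3] by linarith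
  qed
  then show ?thesis
    by (intro filterlim_norm_at_top_imp_at_infinity filterlim_at_top_mono[OF lim] always_eventually allI)
qed

theorem theorem6p1:
  fixes k :: nat and p :: "nat \<Rightarrow> split_complex"
  shows "\<exists>X P g f.
    timelike_minimal_surface_with_ends UNIV P X g f \<and>
    UNIV - plus_null_cone P = UNIV - plus_null_cone (p ` {1..k}) \<and>
    (\<forall>i\<in>{1..k}. p i \<in> P \<and> weak_complete_end (UNIV - plus_null_cone P) X (p i))"
proof -
  define A B where "A = e_coord ` p ` {1..k}" and "B = e_dagger_coord ` p ` {1..k}"
  define U\<^sub>1 U\<^sub>2 where "U\<^sub>1 = - complex_of_real ` A" and "U\<^sub>2 = - complex_of_real ` B"
  define D where "D = bicomplex_domain U\<^sub>1 U\<^sub>2"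
  define G\<^sub>1 G\<^sub>2 where "G\<^sub>1 = end_form A" and "G\<^sub>2 = end_form B"
  define X where "X = null_sum (pole_sum 1 A) (pole_sum 1 B)"
  \<comment> \<open>This is the constant \<open>split_k\<close>, with idempotent coordinates 1 and
    -1.\<close>
  define g where "g = bicomplex_restriction (\<lambda>_. 1) (\<lambda>_. - 1)"
  define f where "f = bicomplex_restriction G\<^sub>1 G\<^sub>2"
  define \<alpha> where "\<alpha> z = (vector [(1 - (g z)\<^sup>2) * f z, 2 * g z * f z, (1 + (g z)\<^sup>2) * f z]
      :: split_complex^3)" for z
  \<comment> \<open>The ends are not chosen but dictated by \<alpha>; their position has to be
    determined below.\<close>
  define P where "P = (\<Union>i. split_poles (\<lambda>z. \<alpha> z $ i) UNIV)"
  have fin: "finite A" "finite B"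
    by (simp_all add: A_def B_def)
  then have U: "open U\<^sub>1" "open U\<^sub>2"
    by (simp_all add: U\<^sub>1_def U\<^sub>2_def finite_imp_closed open_Compl)
  have U_iff: "complex_of_real x \<in> U\<^sub>1 \<longleftrightarrow> x \<notin> A" "complex_of_real x \<in> U\<^sub>2 \<longleftrightarrow> x \<notin> B" for x
    by (auto simp: U\<^sub>1_def U\<^sub>2_def)
  have D: "open D"
    using open_bicomplex_domain[OF U] by (simp add: D_def)
  have G: "G\<^sub>1 nicely_meromorphic_on UNIV" "G\<^sub>2 nicely_meromorphic_on UNIV"
    "G\<^sub>1 holomorphic_on U\<^sub>1" "G\<^sub>2 holomorphic_on U\<^sub>2"
    "\<And>\<beta>. G\<^sub>1 (cnj \<beta>) = cnj (G\<^sub>1 \<beta>)" "\<And>\<beta>. G\<^sub>2 (cnj \<beta>) = cnj (G\<^sub>2 \<beta>)"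
    using fin by (simp_all add: G\<^sub>1_def G\<^sub>2_def U\<^sub>1_def U\<^sub>2_def nicely_meromorphic_end_form
        holomorphic_on_end_form end_form_cnj)
  have g_square: "(g z)\<^sup>2 = 1" for z
    by (rule split_complex_eqI) (simp_all add: g_def)
  have two: "e_coord 2 = 2" "e_dagger_coord 2 = 2"
    using e_coord_simps(5)[of 1 1] e_dagger_coord_simps(5)[of 1 1] by (simp_all del: e_coord_simps(5) e_dagger_coord_simps(5) add: one_add_one)
  \<comment> \<open>The factors \<open>1 - g\<^sup>2\<close>, \<open>2 * g\<close> and
    \<open>1 + g\<^sup>2\<close> have the constant coordinate pairs (0, 0), (2, -2) and (2,
    2).\<close>
  have \<alpha>_eq: "(\<lambda>z. \<alpha> z $ 1) = bicomplex_restriction (\<lambda>\<beta>. complex_of_real 0 * G\<^sub>1 \<beta>) (\<lambda>\<beta>. complex_of_real 0 * G\<^sub>2 \<beta>)"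
    "(\<lambda>z. \<alpha> z $ 2) = bicomplex_restriction (\<lambda>\<beta>. complex_of_real 2 * G\<^sub>1 \<beta>) (\<lambda>\<beta>. complex_of_real (- 2) * G\<^sub>2 \<beta>)"
    "(\<lambda>z. \<alpha> z $ 3) = bicomplex_restriction (\<lambda>\<beta>. complex_of_real 2 * G\<^sub>1 \<beta>) (\<lambda>\<beta>. complex_of_real 2 * G\<^sub>2 \<beta>)"
    by (auto intro!: ext split_complex_eqI simp: \<alpha>_def vector_3 g_square two f_def)
      (simp_all add: g_def)
  have \<alpha>_restriction: "\<exists>c d. (\<lambda>z. \<alpha> z $ i)
      = bicomplex_restriction (\<lambda>\<beta>. complex_of_real c * G\<^sub>1 \<beta>) (\<lambda>\<beta>. complex_of_real d * G\<^sub>2 \<beta>)" for i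
    using exhaust_3[of i] by (elim disjE; simp only:) (intro exI, rule \<alpha>_eq)+
  have g_holo: "split_holomorphic_on g S" if "S = UNIV \<or> S = D" for S
  proof -
    have "bicomplex_domain UNIV UNIV = UNIV"
      by (simp add: bicomplex_domain_def)
    then show ?thesis
      using that U split_holomorphic_on_bicomplex_restriction[of UNIV UNIV "\<lambda>_. 1" "\<lambda>_. - 1"]
        split_holomorphic_on_bicomplex_restriction[of U\<^sub>1 U\<^sub>2 "\<lambda>_. 1" "\<lambda>_. - 1"]
      by (auto simp: g_def D_def)
  qed
  have g_mero: "split_meromorphic_on g S" if "open S" for S
    unfolding g_def
    by (rule split_meromorphic_on_bicomplex_restriction) (use that in auto)
  have f_holo: "split_holomorphic_on f D"
    unfolding f_def D_def by (rule split_holomorphic_on_bicomplex_restriction[OF U G(3,4)])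
  have \<alpha>_holo: "split_holomorphic_on (\<lambda>z. \<alpha> z $ i) D" for i
  proof -
    obtain c d where "(\<lambda>z. \<alpha> z $ i)
      = bicomplex_restriction (\<lambda>\<beta>. complex_of_real c * G\<^sub>1 \<beta>) (\<lambda>\<beta>. complex_of_real d * G\<^sub>2 \<beta>)"
      using \<alpha>_restriction by blast
    then show ?thesis
      unfolding D_def
      using split_holomorphic_on_bicomplex_restriction[OF U] G(3,4) by (simp add: holomorphic_on_mult)
  qed
  have \<alpha>_mero: "split_meromorphic_on (\<lambda>z. \<alpha> z $ i) UNIV" for i
  proof -
    obtain c d where "(\<lambda>z. \<alpha> z $ i)
      = bicomplex_restriction (\<lambda>\<beta>. complex_of_real c * G\<^sub>1 \<beta>) (\<lambda>\<beta>. complex_of_real d * G\<^sub>2 \<beta>)"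
      using \<alpha>_restriction by blast
    then show ?thesis
      by (simp add: split_meromorphic_on_bicomplex_restriction nicely_meromorphic_on_cmult_left G)
  qed
  have cont: "isCont (\<lambda>x. Re (complex_of_real c * G (complex_of_real x))) x"
    if "open U" "G holomorphic_on U" "complex_of_real x \<in> U" for c x G U
  proof -
    have "isCont G (complex_of_real x)"
      using that holomorphic_on_imp_continuous_on[OF that(2)] by (simp add: continuous_on_eq_continuous_at)
    then have "isCont (\<lambda>x. G (complex_of_real x)) x"
      by (intro isCont_o2[where f = complex_of_real and g = G]) simp_all
    then show ?thesis
      unfolding isCont_def by (intro tendsto_intros)
  qed
  \<comment> \<open>Multiples of \<open>G\<^sub>1\<close> and \<open>G\<^sub>2\<close> are
    continuous at real points off \<open>A\<close> and \<open>B\<close>, so by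
    \<open>split_poles_coords\<close> every pole lies on the grid.\<close>
  have P_coords: "e_coord q \<in> A" "e_dagger_coord q \<in> B" if "q \<in> P" for q
  proof -
    obtain i where i: "q \<in> split_poles (\<lambda>z. \<alpha> z $ i) UNIV"
      using \<open>q \<in> P\<close> unfolding P_def by blast
    obtain c d where cd: "(\<lambda>z. \<alpha> z $ i)
      = bicomplex_restriction (\<lambda>\<beta>. complex_of_real c * G\<^sub>1 \<beta>) (\<lambda>\<beta>. complex_of_real d * G\<^sub>2 \<beta>)"
      using \<alpha>_restriction by blast
    have "\<not> isCont (\<lambda>x. Re (complex_of_real c * G\<^sub>1 (complex_of_real x))) (e_coord q)"
      "\<not> isCont (\<lambda>x. Re (complex_of_real d * G\<^sub>2 (complex_of_real x))) (e_dagger_coord q)"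
      using split_poles_coords[OF i[unfolded cd] open_UNIV bicomplex_restriction_coords] .
    then show "e_coord q \<in> A" "e_dagger_coord q \<in> B"
      using cont[OF U(1) G(3), of "e_coord q" c] cont[OF U(2) G(4), of "e_dagger_coord q" d]
      by (auto simp: U_iff)
  qed
  \<comment> \<open>In the third component both coordinate factors are 2, so both poles
    survive.\<close>
  have p_in_P: "p i \<in> P" if "i \<in> {1..k}" for i
  proof -
    have "is_pole G\<^sub>1 (complex_of_real (e_coord (p i)))" "is_pole G\<^sub>2 (complex_of_real (e_dagger_coord (p i)))"
      using that fin by (auto simp: G\<^sub>1_def G\<^sub>2_def A_def B_def intro!: is_pole_end_form)
    then have "p i \<in> split_poles (\<lambda>z. \<alpha> z $ 3) UNIV"
      unfolding \<alpha>_eq split_poles_def using G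
      by (auto intro!: exI bicomplex_representation_restriction nicely_meromorphic_on_cmult_left disjI2)
    then show ?thesis
      unfolding P_def by blast
  qed
  \<comment> \<open>\<open>P\<close> lies between the prescribed points and the grid they span,
    which have the same projections and hence the same null lines.\<close>
  have "e_coord ` P = e_coord ` p ` {1..k}" "e_dagger_coord ` P = e_dagger_coord ` p ` {1..k}"
    using P_coords p_in_P by (auto simp: A_def B_def)
  then have cone: "plus_null_cone P = plus_null_cone (p ` {1..k})"
    by (simp add: plus_null_cone_eq)
  then have D_eq: "UNIV - plus_null_cone P = D"
    by (simp add: D_def U\<^sub>1_def U\<^sub>2_def A_def B_def bicomplex_domain_Compl_eq)
  have surface: "timelike_minimal_surface D X"
    unfolding D_def X_def using U holomorphic_on_pole_sum
    by (intro timelike_minimal_surface_null_sum) (simp_all add: U\<^sub>1_def U\<^sub>2_def)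
  have X_deriv: "(X has_derivative (\<lambda>h. \<chi> i. sRe (\<alpha> z $ i * h))) (at z)" if z: "z \<in> D" for z
  proof -
    have deriv_eq: "deriv (pole_sum 1 A) (complex_of_real (e_coord z)) = G\<^sub>1 (complex_of_real (e_coord z))"
      "deriv (pole_sum 1 B) (complex_of_real (e_dagger_coord z)) = G\<^sub>2 (complex_of_real (e_dagger_coord z))"
      using z by (simp_all add: D_def bicomplex_domain_def U\<^sub>1_def U\<^sub>2_def G\<^sub>1_def G\<^sub>2_def end_form_eq_deriv del: One_nat_def)
    have "(X has_derivative
      (\<lambda>h. (Re (G\<^sub>1 (complex_of_real (e_coord z))) * e_coord h) *\<^sub>R vector [0, 1, 1]
      + (Re (G\<^sub>2 (complex_of_real (e_dagger_coord z))) * e_dagger_coord h)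
        *\<^sub>R vector [0, - 1, 1])) (at z)"
      using has_derivative_null_sum[OF U, of "pole_sum 1 A" "pole_sum 1 B" z] z
      unfolding X_def deriv_eq by (simp add: D_def U\<^sub>1_def U\<^sub>2_def holomorphic_on_pole_sum)
    moreover have "(\<lambda>h. (Re (G\<^sub>1 (complex_of_real (e_coord z))) * e_coord h) *\<^sub>R vector [0, 1, 1]
      + (Re (G\<^sub>2 (complex_of_real (e_dagger_coord z))) * e_dagger_coord h)
        *\<^sub>R vector [0, - 1, 1]) = (\<lambda>h. \<chi> i. sRe (\<alpha> z $ i * h))"
      \<comment> \<open>\<open>sRe\<close> is half the sum of the idempotent coordinates; this half
        cancels the factor 2 in the components of \<alpha>.\<close>
      using fun_cong[OF \<alpha>_eq(1), of z] fun_cong[OF \<alpha>_eq(2), of z] fun_cong[OF \<alpha>_eq(3), of z]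
      by (simp add: fun_eq_iff vec_eq_iff forall_3 vector_3 sRe_eq_coords field_simps)
    ultimately show ?thesis by simp
  qed
  have form: "weierstrass_form S g f \<alpha>" for S
    by (simp add: weierstrass_form_def \<alpha>_def)
  \<comment> \<open>The domain must be shown nonempty to exhibit a point where the Gauss map is not
    real.\<close>
  obtain x y where "x \<notin> A" "y \<notin> B"
    using fin ex_new_if_finite[OF infinite_UNIV_char_0] by metis
  then have "x *\<^sub>R split_e + y *\<^sub>R split_e_dagger \<in> D"
    by (simp add: D_def bicomplex_domain_def U_iff)
  moreover have "sIm (g z) \<noteq> 0" for z
    by (simp add: sIm_eq_coords g_def)
  ultimately have nonreal: "\<exists>z\<in>D. split_regular g z \<and> sIm (g z) \<noteq> 0"
    using split_regular_if_holomorphic g_holo by blast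
  \<comment> \<open>Since \<open>g\<^sup>2 = 1\<close>, the continuation of
    \<open>f g\<^sup>2\<close> required by the definition is \<open>f\<close> itself.\<close>
  have "has_weierstrass_data D X g f"
    unfolding has_weierstrass_data_def
    using g_mero[OF D] f_holo nonreal \<alpha>_holo form X_deriv g_square by auto
  moreover have "split_meromorphic_on f UNIV"
    unfolding f_def by (intro split_meromorphic_on_bicomplex_restriction G) simp
  ultimately have "timelike_minimal_surface_with_ends UNIV P X g f"
    unfolding timelike_minimal_surface_with_ends_def D_eq
    using g_mero \<alpha>_mero form surface by (auto simp: P_def)
  moreover have "weak_complete_end D X (p i)" if "i \<in> {1..k}" for i
  proof (rule weak_complete_end_if_unbounded[OF D])
    have pA: "e_coord (p i) \<in> A"
      using that by (auto simp: A_def)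
    then have ne: "e_coord z \<noteq> e_coord (p i)" if "z \<in> D" for z
      using that by (auto simp: D_def bicomplex_domain_def U_iff)
    show "C2_on X D"
      using surface by (simp add: timelike_minimal_surface_def)
    show "p i \<notin> D"
      using ne by blast
    show "filterlim X at_infinity (at (p i) within D)"
      unfolding X_def
      by (intro filterlim_null_sum_at_infinity is_pole_pole_sum fin pA pole_sum_cnj ne) simp_all
  qed
  ultimately show ?thesis
    using cone D_eq p_in_P by blast
qed

end
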